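(* There is an algorithm that, given a connected graph $G=(V,E)$ with $n$ nodes and $m$ edges and an integer $k\ge 2$, determines in time $O(nm)$ either a matching-$k$-cover of $G$ or a stable set $S$ of $G$ with $|S|>k\,|N(S)|$.
   Context: Graphs are finite and simple (no loops or parallel edges). A matching is a set of pairwise node-disjoint edges (possibly empty). A matching-$k$-cover of $G=(V,E)$ is a collection of $k$ matchings of $G$ such that every node of $V$ is incident to at least one edge of their union. A stable set is a set of pairwise non-adjacent nodes. For $U\subseteq V$, $N(U)=\{v\in V\setminus U:\text{ there exists }u\in U\text{ with }uv\in E\}$. *)

theory Defs
  imports Main
begin

section \<open>Graphs\<close>

text \<open>A graph is a pair of a node set \<open>V\<close> and a set \<open>E\<close> of two-element edges.\<close>

definition simple_graph :: "'a set \<Rightarrow> 'a set set \<Rightarrow> bool" where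
  "simple_graph V E \<longleftrightarrow>
     finite V \<and> (\<forall>e\<in>E. \<exists>u v. e = {u, v} \<and> u \<in> V \<and> v \<in> V \<and> u \<noteq> v)"

text \<open>The graph without nodes does not count as connected.\<close>

definition graph_connected :: "'a set \<Rightarrow> 'a set set \<Rightarrow> bool" where
  "graph_connected V E \<longleftrightarrow>
     V \<noteq> {} \<and> (\<forall>u\<in>V. \<forall>v\<in>V. (u, v) \<in> {(x, y). {x, y} \<in> E}\<^sup>*)"

definition matching :: "'a set set \<Rightarrow> 'a set set \<Rightarrow> bool" where
  "matching E M \<longleftrightarrow> M \<subseteq> E \<and> pairwise disjnt M"

text \<open>
  The collection of \<open>k\<close> matchings is an indexed family \<open>M 0, \<dots>, M (k - 1)\<close>, so the
  same matching (for instance the empty one) may occur several times.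
\<close>

definition matching_k_cover ::
  "'a set \<Rightarrow> 'a set set \<Rightarrow> nat \<Rightarrow> (nat \<Rightarrow> 'a set set) \<Rightarrow> bool" where
  "matching_k_cover V E k M \<longleftrightarrow>
     (\<forall>i<k. matching E (M i)) \<and> (\<forall>v\<in>V. \<exists>e \<in> (\<Union>i<k. M i). v \<in> e)"

definition stable_set :: "'a set \<Rightarrow> 'a set set \<Rightarrow> 'a set \<Rightarrow> bool" where
  "stable_set V E S \<longleftrightarrow> S \<subseteq> V \<and> (\<forall>u\<in>S. \<forall>v\<in>S. {u, v} \<notin> E)"

definition nbhd :: "'a set \<Rightarrow> 'a set set \<Rightarrow> 'a set \<Rightarrow> 'a set" where
  "nbhd V E U = {v \<in> V - U. \<exists>u\<in>U. {u, v} \<in> E}"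


section \<open>Algorithms and their running time\<close>

text \<open>
  Algorithms are programs for a unit-cost random access machine with finitely many
  registers and finitely many arrays, each cell holding a natural number. The only
  arithmetic is increment and decrement (with \<open>0 - 1 = 0\<close>), together with
  comparisons. Hence after \<open>t\<close> steps no cell exceeds \<open>t\<close> plus the largest number among
  the input and the constants of the program: charging one unit per operation
  cannot be exploited by computing with very long numbers. A fortiori such a
  program runs in the same time on machines with a richer instruction set.
\<close>

type_synonym vname = string

record state =
  regs :: "vname \<Rightarrow> nat"
  arrs :: "vname \<Rightarrow> nat \<Rightarrow> nat"

datatype expr =
    Const nat
  | Reg vname
  | Read vname expr
  | Incr expr
  | Decr expr

datatype cond =
    Less expr expr
  | Equal expr expr
  | Neg cond
  | Conj cond cond

datatype com =
    Skip
  | Assign vname expr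
  | Write vname expr expr
  | Seq com com
  | Branch cond com com
  | While cond com

primrec eval_expr :: "expr \<Rightarrow> state \<Rightarrow> nat" where
  "eval_expr (Const a) s = a"
| "eval_expr (Reg x) s = regs s x"
| "eval_expr (Read A e) s = arrs s A (eval_expr e s)"
| "eval_expr (Incr e) s = eval_expr e s + 1"
| "eval_expr (Decr e) s = eval_expr e s - 1"

primrec eval_cond :: "cond \<Rightarrow> state \<Rightarrow> bool" where
  "eval_cond (Less d e) s \<longleftrightarrow> eval_expr d s < eval_expr e s"
| "eval_cond (Equal d e) s \<longleftrightarrow> eval_expr d s = eval_expr e s"
| "eval_cond (Neg b) s \<longleftrightarrow> \<not> eval_cond b s"
| "eval_cond (Conj a b) s \<longleftrightarrow> eval_cond a s \<and> eval_cond b s"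

primrec expr_cost :: "expr \<Rightarrow> nat" where
  "expr_cost (Const a) = 1"
| "expr_cost (Reg x) = 1"
| "expr_cost (Read A e) = 1 + expr_cost e"
| "expr_cost (Incr e) = 1 + expr_cost e"
| "expr_cost (Decr e) = 1 + expr_cost e"

primrec cond_cost :: "cond \<Rightarrow> nat" where
  "cond_cost (Less d e) = 1 + expr_cost d + expr_cost e"
| "cond_cost (Equal d e) = 1 + expr_cost d + expr_cost e"
| "cond_cost (Neg b) = 1 + cond_cost b"
| "cond_cost (Conj a b) = 1 + cond_cost a + cond_cost b"

definition set_reg :: "vname \<Rightarrow> nat \<Rightarrow> state \<Rightarrow> state" where
  "set_reg x a s = s\<lparr>regs := (regs s)(x := a)\<rparr>"

definition set_cell :: "vname \<Rightarrow> nat \<Rightarrow> nat \<Rightarrow> state \<Rightarrow> state" where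
  "set_cell A i a s = s\<lparr>arrs := (arrs s)(A := (arrs s A)(i := a))\<rparr>"

text \<open>
  \<open>exec c s t s'\<close>: started in state \<open>s\<close>, the program \<open>c\<close> terminates in state \<open>s'\<close>
  after \<open>t\<close> steps.
\<close>

inductive exec :: "com \<Rightarrow> state \<Rightarrow> nat \<Rightarrow> state \<Rightarrow> bool" where
  Skip: "exec Skip s 1 s"
| Assign: "exec (Assign x e) s (1 + expr_cost e) (set_reg x (eval_expr e s) s)"
| Write: "exec (Write A d e) s (1 + expr_cost d + expr_cost e)
            (set_cell A (eval_expr d s) (eval_expr e s) s)"
| Seq: "exec c s t s' \<Longrightarrow> exec c' s' t' s'' \<Longrightarrow> exec (Seq c c') s (t + t') s''"
| BranchTrue: "eval_cond b s \<Longrightarrow> exec c s t s' \<Longrightarrow>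
            exec (Branch b c c') s (1 + cond_cost b + t) s'"
| BranchFalse: "\<not> eval_cond b s \<Longrightarrow> exec c' s t s' \<Longrightarrow>
            exec (Branch b c c') s (1 + cond_cost b + t) s'"
| WhileFalse: "\<not> eval_cond b s \<Longrightarrow> exec (While b c) s (1 + cond_cost b) s"
| WhileTrue: "eval_cond b s \<Longrightarrow> exec c s t s' \<Longrightarrow> exec (While b c) s' t' s'' \<Longrightarrow>
            exec (While b c) s (1 + cond_cost b + t + t') s''"

inductive_cases Skip_cases: "exec Skip s t s'"
inductive_cases Assign_cases: "exec (Assign x e) s t s'"
inductive_cases Write_cases: "exec (Write A d e) s t s'"
inductive_cases Seq_cases: "exec (Seq c c') s t s'"
inductive_cases Branch_cases: "exec (Branch b c c') s t s'"
inductive_cases While_cases: "exec (While b c) s t s'"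

text \<open>Execution is deterministic, so each run has one running time and one result.\<close>

lemma exec_deterministic:
  "exec c s t s' \<Longrightarrow> exec c s u r \<Longrightarrow> u = t \<and> r = s'"
proof (induction arbitrary: u r rule: exec.induct)
  case (Skip s)
  then show ?case by (auto elim: Skip_cases)
next
  case (Assign x e s)
  then show ?case by (auto elim: Assign_cases)
next
  case (Write A d e s)
  then show ?case by (auto elim: Write_cases)
next
  case (Seq c s t s' c' t' s'')
  from Seq.prems show ?case by (rule Seq_cases) (metis Seq.IH)
next
  case (BranchTrue b s c t s' c')
  from BranchTrue.prems show ?case by (rule Branch_cases) (auto simp: BranchTrue.hyps(1) dest!: BranchTrue.IH)+
next
  case (BranchFalse b s c' t s' c)
  from BranchFalse.prems show ?case by (rule Branch_cases) (auto simp: BranchFalse.hyps(1) dest!: BranchFalse.IH)+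
next
  case (WhileFalse b s c)
  from WhileFalse.prems show ?case by (rule While_cases) (auto simp: WhileFalse.hyps)+
next
  case (WhileTrue b s c t s' t' s'')
  from WhileTrue.prems show ?case by (rule While_cases) (auto simp: WhileTrue.hyps(1) dest!: WhileTrue.IH)+
qed


section \<open>Input and output conventions\<close>

text \<open>
  The nodes of the input graph are numbered \<open>0, \<dots>, n - 1\<close>, and its edges are given in
  arbitrary order and orientation, each of them once. All registers and array cells
  that do not carry input are initially \<open>0\<close>.
\<close>

definition edge_listing :: "'a set set \<Rightarrow> ('a \<times> 'a) list \<Rightarrow> bool" where
  "edge_listing E es \<longleftrightarrow>
     distinct (map (\<lambda>(u, v). {u, v}) es) \<and> set (map (\<lambda>(u, v). {u, v}) es) = E"

definition input_state :: "nat \<Rightarrow> (nat \<times> nat) list \<Rightarrow> nat \<Rightarrow> state" where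
  "input_state n es k =
     \<lparr>regs = (\<lambda>_. 0)(''n'' := n, ''m'' := length es, ''k'' := k),
      arrs = (\<lambda>_ _. 0)
        (''src'' := (\<lambda>j. if j < length es then fst (es ! j) else 0),
         ''dst'' := (\<lambda>j. if j < length es then snd (es ! j) else 0))\<rparr>"

text \<open>
  A family of matchings is output as a list of \<open>len\<close> triples \<open>(i, u, v)\<close>, each saying
  that the edge \<open>uv\<close> belongs to the matching with index \<open>i\<close>. Matchings without a triple
  are empty; this is what permits an output of size independent of \<open>k\<close>, which may
  be arbitrarily large compared to \<open>n\<close> and \<open>m\<close>. A set of nodes is output as a list of
  \<open>len\<close> nodes.
\<close>

definition out_indices :: "state \<Rightarrow> nat set" where
  "out_indices s = {arrs s ''index'' j | j. j < regs s ''len''}"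

definition out_matchings :: "state \<Rightarrow> nat \<Rightarrow> nat set set" where
  "out_matchings s i =
     {{arrs s ''end1'' j, arrs s ''end2'' j} | j. j < regs s ''len'' \<and> arrs s ''index'' j = i}"

definition out_nodes :: "state \<Rightarrow> nat set" where
  "out_nodes s = {arrs s ''node'' j | j. j < regs s ''len''}"

end

theory Submission
  imports Defs
begin

text \<open>
  For \<open>k \<ge> 2\<close>, a star with at most \<open>k\<close> leaves is the union of \<open>k\<close> matchings, each consisting
  of at most one edge. So node-disjoint stars with between \<open>1\<close> and \<open>k\<close> leaves that
  together contain all nodes yield a matching-\<open>k\<close>-cover: number the leaves of each star, and
  let the \<open>i\<close>-th matching consist of the edges to the leaves with number \<open>i\<close>. The program
  builds such stars, treating the nodes \<open>r\<close> one after the other by an augmenting path method.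

  If \<open>r\<close> lies in no star yet, a breadth-first search collects \<^emph>\<open>outer\<close> nodes: \<open>r\<close> itself, and the
  leaves of every full star (one with \<open>k\<close> leaves) whose centre is adjacent to an outer node.
  Each outer node can be made the one that still has to be covered: every full centre on the
  path to it takes over the preceding outer node and releases one of its own leaves. Suppose
  that an outer node \<open>u\<close> has a neighbour \<open>v\<close> other than a full centre. Then \<open>v\<close> can be made a
  centre with room for one more leaf without uncovering any other node. This is clear if \<open>v\<close>
  is a centre already or is itself uncovered. If \<open>v\<close> is one of several leaves of a star, it is
  cut off, and if it is the only one, centre and leaf exchange roles, which leaves room for a
  second leaf because \<open>k \<ge> 2\<close>. Now \<open>u\<close> is attached to \<open>v\<close> and the leaves along the path from
  \<open>r\<close> to \<open>u\<close> are shifted, so that \<open>r\<close> is covered as well (\<open>augment\<close>).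

  Otherwise all neighbours of outer nodes are full centres, and all leaves of these are outer.
  As outer nodes are not full centres, they form a stable set \<open>S\<close>, and since \<open>S\<close> contains the
  \<open>k\<close> leaves of each of its neighbours and in addition \<open>r\<close>, \<open>|S| > k |N(S)|\<close>
  (\<open>search_inv_violator\<close>).

  With adjacency lists one search goes through the list of each node at most once, hence costs
  \<open>O(n + m)\<close>, an augmentation costs \<open>O(n)\<close>, and there are at most \<open>n\<close> of each. The lists are
  built by going through all edges once for every node, in time \<open>O(n m + n)\<close>. This gives
  \<open>O(n m + n\<^sup>2 + n)\<close> altogether (\<open>cover_program\<close>), and \<open>n \<le> 2 m\<close> for connected graphs with
  more than one node.
\<close>

section \<open>A calculus for total correctness with running time\<close>

text \<open>
  Execution is deterministic, so the existence of a run with a property is the weakest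
  precondition for total correctness. The postcondition sees the running time.
\<close>

definition wp :: "com \<Rightarrow> (nat \<Rightarrow> state \<Rightarrow> bool) \<Rightarrow> state \<Rightarrow> bool" where
  "wp c Q s \<longleftrightarrow> (\<exists>t s'. exec c s t s' \<and> Q t s')"

primrec block :: "com list \<Rightarrow> com" where
  "block [] = Skip"
| "block (c # cs) = Seq c (block cs)"

abbreviation incr :: "vname \<Rightarrow> com" where
  "incr x \<equiv> Assign x (Incr (Reg x))"

lemma wp_Skip [simp]: "wp Skip Q s = Q 1 s"
  unfolding wp_def by (auto elim: Skip_cases intro: exec.Skip[simplified])

lemma wp_Assign [simp]:
  "wp (Assign x e) Q s = Q (1 + expr_cost e) (set_reg x (eval_expr e s) s)"
  unfolding wp_def by (auto elim: Assign_cases intro: exec.Assign[simplified])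

lemma wp_Write [simp]:
  "wp (Write A d e) Q s =
    Q (1 + expr_cost d + expr_cost e) (set_cell A (eval_expr d s) (eval_expr e s) s)"
  unfolding wp_def by (auto elim: Write_cases intro: exec.Write[simplified])

lemma wp_Seq [simp]:
  "wp (Seq c c') Q s = wp c (\<lambda>t. wp c' (\<lambda>t'. Q (t + t'))) s"
  unfolding wp_def by (fastforce elim: Seq_cases intro: exec.Seq)

lemma wp_Branch [simp]:
  "wp (Branch b c c') Q s =
    (if eval_cond b s then wp c (\<lambda>t. Q (1 + cond_cost b + t)) s
     else wp c' (\<lambda>t. Q (1 + cond_cost b + t)) s)"
  unfolding wp_def
  by (auto elim!: Branch_cases intro: exec.BranchTrue[simplified] exec.BranchFalse[simplified])

primrec written_regs :: "com \<Rightarrow> vname set" where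
  "written_regs Skip = {}"
| "written_regs (Assign x e) = {x}"
| "written_regs (Write A d e) = {}"
| "written_regs (Seq c c') = written_regs c \<union> written_regs c'"
| "written_regs (Branch b c c') = written_regs c \<union> written_regs c'"
| "written_regs (While b c) = written_regs c"

primrec written_arrs :: "com \<Rightarrow> vname set" where
  "written_arrs Skip = {}"
| "written_arrs (Assign x e) = {}"
| "written_arrs (Write A d e) = {A}"
| "written_arrs (Seq c c') = written_arrs c \<union> written_arrs c'"
| "written_arrs (Branch b c c') = written_arrs c \<union> written_arrs c'"
| "written_arrs (While b c) = written_arrs c"

text \<open>
  What a program leaves alone can be read off its text. The rule for loops below therefore
  supplies this information, and loop invariants need only mention what changes.
\<close>

definition frame :: "com \<Rightarrow> state \<Rightarrow> state \<Rightarrow> bool" where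
  "frame c s s' \<longleftrightarrow>
     (\<forall>x. x \<notin> written_regs c \<longrightarrow> regs s' x = regs s x) \<and>
     (\<forall>A. A \<notin> written_arrs c \<longrightarrow> arrs s' A = arrs s A)"

lemma regs_set_reg [simp]: "regs (set_reg x a s) y = (if y = x then a else regs s y)"
  and arrs_set_reg [simp]: "arrs (set_reg x a s) = arrs s"
  and regs_set_cell [simp]: "regs (set_cell A i a s) = regs s"
  and arrs_set_cell [simp]:
    "arrs (set_cell A i a s) B = (if B = A then (arrs s A)(i := a) else arrs s B)"
  by (simp_all add: set_reg_def set_cell_def)

lemma exec_frame: "exec c s t s' \<Longrightarrow> frame c s s'"
  by (induction rule: exec.induct) (simp_all add: frame_def)

lemma wp_conseq:
  assumes "wp c Q s" and "\<And>t s'. Q t s' \<Longrightarrow> frame c s s' \<Longrightarrow> R t s'"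
  shows "wp c R s"
  using assms exec_frame unfolding wp_def by blast

lemma frame_trans: "frame c s s' \<Longrightarrow> frame c s' s'' \<Longrightarrow> frame c s s''"
  by (simp add: frame_def)

text \<open>
  The number \<open>\<phi>\<close> is a credit that pays for the remaining iterations. Since every evaluation
  of the loop condition costs something, a credit that covers all costs also proves
  termination, and no separate variant is needed. What is left of the credit at the end is
  returned, so that nested loops can share one credit.
\<close>

lemma wp_While:
  fixes I :: "nat \<Rightarrow> state \<Rightarrow> bool"
  assumes init: "I \<phi> s"
    and step: "\<And>\<phi> s'. I \<phi> s' \<Longrightarrow> frame c s s' \<Longrightarrow> eval_cond b s' \<Longrightarrow>
      wp c (\<lambda>t s''. \<exists>\<phi>'. I \<phi>' s'' \<and> 1 + cond_cost b + t + \<phi>' \<le> \<phi>) s'"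
    and exit: "\<And>\<phi>' t s'. I \<phi>' s' \<Longrightarrow> frame c s s' \<Longrightarrow> \<not> eval_cond b s' \<Longrightarrow>
      t + \<phi>' \<le> 1 + cond_cost b + \<phi> \<Longrightarrow> Q t s'"
  shows "wp (While b c) Q s"
proof -
  have "wp (While b c)
      (\<lambda>t s'. \<exists>\<phi>'. I \<phi>' s' \<and> \<not> eval_cond b s' \<and> t + \<phi>' \<le> 1 + cond_cost b + \<phi>) s'"
    if "I \<phi> s'" and "frame c s s'" for \<phi> s'
    using that
  proof (induction \<phi> arbitrary: s' rule: less_induct)
    case (less \<phi>)
    show ?case
    proof (cases "eval_cond b s'")
      case False
      then show ?thesis
        unfolding wp_def using exec.WhileFalse less.prems(1) by fastforce
    next
      case True
      from step[OF less.prems True] obtain t s1 \<phi>1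
        where run: "exec c s' t s1" and I1: "I \<phi>1 s1" and pay: "1 + cond_cost b + t + \<phi>1 \<le> \<phi>"
        unfolding wp_def by blast
      have "frame c s s1"
        using less.prems(2) exec_frame[OF run] by (rule frame_trans)
      with less.IH[of \<phi>1 s1] I1 pay obtain t' s2 \<phi>2
        where run': "exec (While b c) s1 t' s2" and I2: "I \<phi>2 s2" "\<not> eval_cond b s2"
          and pay': "t' + \<phi>2 \<le> 1 + cond_cost b + \<phi>1"
        unfolding wp_def by auto
      have "exec (While b c) s' (1 + cond_cost b + t + t') s2"
        using True run run' by (rule exec.WhileTrue)
      moreover have "(1 + cond_cost b + t + t') + \<phi>2 \<le> 1 + cond_cost b + \<phi>"
        using pay pay' by linarith
      ultimately show ?thesis unfolding wp_def using I2 by blast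
    qed
  qed
  from this[OF init] have "wp (While b c)
      (\<lambda>t s'. \<exists>\<phi>'. I \<phi>' s' \<and> \<not> eval_cond b s' \<and> t + \<phi>' \<le> 1 + cond_cost b + \<phi>) s"
    by (simp add: frame_def)
  then show ?thesis
    by (rule wp_conseq) (auto simp: frame_def intro: exit)
qed

section \<open>The star covering program\<close>

text \<open>
  The neighbours of \<open>u\<close> are stored consecutively, in the cells \<open>start u, \<dots>, start (u + 1) - 1\<close>
  of the array \<open>adj\<close>.
\<close>

definition scan_edges :: com where
  "scan_edges = While (Less (Reg ''j'') (Reg ''m'')) (block
     [Branch (Equal (Read ''src'' (Reg ''j'')) (Reg ''u''))
        (block [Write ''adj'' (Reg ''p'') (Read ''dst'' (Reg ''j'')), incr ''p''])
        (Branch (Equal (Read ''dst'' (Reg ''j'')) (Reg ''u''))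
          (block [Write ''adj'' (Reg ''p'') (Read ''src'' (Reg ''j'')), incr ''p''])
          Skip),
      incr ''j''])"

definition build_adjacency :: com where
  "build_adjacency = While (Less (Reg ''u'') (Reg ''n'')) (block
     [Assign ''j'' (Const 0),
      scan_edges,
      incr ''u'',
      Write ''start'' (Reg ''u'') (Reg ''p'')])"

text \<open>
  The leaves of \<open>v\<close> are found among its neighbours. So the stars need no other representation
  than the array \<open>par\<close>, which holds \<open>c + 1\<close> for a leaf of the star with centre \<open>c\<close> and \<open>0\<close> for
  all other nodes, together with the numbers \<open>cnt\<close> of leaves. The array \<open>node\<close> is both the queue
  of the search and, if the search fails, the output: it contains exactly the outer nodes.
\<close>

definition push_leaves :: com where
  "push_leaves = While (Less (Reg ''q'') (Read ''start'' (Incr (Reg ''v'')))) (block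
     [Assign ''w'' (Read ''adj'' (Reg ''q'')),
      Branch (Equal (Read ''par'' (Reg ''w'')) (Incr (Reg ''v'')))
        (block [Write ''node'' (Reg ''len'') (Reg ''w''), incr ''len''])
        Skip,
      incr ''q''])"

text \<open>
  The full centres reached from the root \<open>r\<close> are marked with \<open>r + 1\<close>. As each node is a
  root at most once, marks of earlier searches never have to be erased.
\<close>

definition visit_neighbour :: com where
  "visit_neighbour = block
     [Assign ''v'' (Read ''adj'' (Reg ''p'')),
      Branch (Conj (Equal (Read ''par'' (Reg ''v'')) (Const 0))
                   (Equal (Read ''cnt'' (Reg ''v'')) (Reg ''k'')))
        (Branch (Equal (Read ''mark'' (Reg ''v'')) (Incr (Reg ''r'')))
          Skip
          (block
            [Write ''mark'' (Reg ''v'') (Incr (Reg ''r'')),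
             Write ''pred'' (Reg ''v'') (Reg ''u''),
             Assign ''q'' (Read ''start'' (Reg ''v'')),
             push_leaves]))
        (Assign ''found'' (Const 1)),
      incr ''p'']"

definition scan_neighbours :: com where
  "scan_neighbours =
     While (Conj (Less (Reg ''p'') (Read ''start'' (Incr (Reg ''u''))))
                 (Equal (Reg ''found'') (Const 0)))
       visit_neighbour"

definition search_loop :: com where
  "search_loop =
     While (Conj (Less (Reg ''i'') (Reg ''len'')) (Equal (Reg ''found'') (Const 0))) (block
     [Assign ''u'' (Read ''node'' (Reg ''i'')),
      Assign ''p'' (Read ''start'' (Reg ''u'')),
      scan_neighbours,
      incr ''i''])"

definition search :: com where
  "search = block
     [Write ''node'' (Const 0) (Reg ''r''),
      Assign ''len'' (Const 1),
      Assign ''i'' (Const 0),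
      Assign ''found'' (Const 0),
      search_loop]"

text \<open>
  In the inner branch, \<open>v\<close> was the only leaf of \<open>c\<close>, and the two exchange roles.
\<close>

definition make_centre :: com where
  "make_centre =
     Branch (Equal (Read ''par'' (Reg ''v'')) (Const 0))
       Skip
       (block
         [Assign ''c'' (Decr (Read ''par'' (Reg ''v''))),
          Write ''par'' (Reg ''v'') (Const 0),
          Write ''cnt'' (Reg ''c'') (Decr (Read ''cnt'' (Reg ''c''))),
          Branch (Equal (Read ''cnt'' (Reg ''c'')) (Const 0))
            (block
              [Write ''cnt'' (Reg ''v'') (Incr (Read ''cnt'' (Reg ''v''))),
               Write ''par'' (Reg ''c'') (Incr (Reg ''v''))])
            Skip])"

text \<open>
  The node \<open>a\<close> leaves its star, whose centre \<open>c\<close> lies on the search path, and joins the star of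
  \<open>t\<close>. The gap at \<open>c\<close> is then filled by the outer node from which \<open>c\<close> was reached. The root is
  the only outer node that is not a leaf, so the loop stops there.
\<close>

definition shift_leaves :: com where
  "shift_leaves =
     While (Neg (Equal (Read ''par'' (Reg ''a'')) (Const 0))) (block
     [Assign ''c'' (Decr (Read ''par'' (Reg ''a''))),
      Write ''par'' (Reg ''a'') (Incr (Reg ''t'')),
      Assign ''t'' (Reg ''c''),
      Assign ''a'' (Read ''pred'' (Reg ''c''))])"

definition augment :: com where
  "augment = block
     [make_centre,
      Write ''cnt'' (Reg ''v'') (Incr (Read ''cnt'' (Reg ''v''))),
      Assign ''t'' (Reg ''v''),
      Assign ''a'' (Reg ''u''),
      shift_leaves,
      Write ''par'' (Reg ''a'') (Incr (Reg ''t''))]"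

definition cover_all :: com where
  "cover_all =
     While (Conj (Less (Reg ''r'') (Reg ''n'')) (Equal (Reg ''cover'') (Const 1))) (block
     [Branch (Conj (Equal (Read ''par'' (Reg ''r'')) (Const 0))
                   (Equal (Read ''cnt'' (Reg ''r'')) (Const 0)))
        (block
          [search,
           Branch (Equal (Reg ''found'') (Const 1)) augment (Assign ''cover'' (Const 0))])
        Skip,
      incr ''r''])"

text \<open>
  Counting \<open>cnt c\<close> down hands out different indices below \<open>k\<close> to the leaves of \<open>c\<close>.
\<close>

definition list_edges :: com where
  "list_edges =
     While (Less (Reg ''w'') (Reg ''n'')) (block
     [Branch (Equal (Read ''par'' (Reg ''w'')) (Const 0))
        Skip
        (block
          [Assign ''c'' (Decr (Read ''par'' (Reg ''w''))),
           Write ''cnt'' (Reg ''c'') (Decr (Read ''cnt'' (Reg ''c''))),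
           Write ''index'' (Reg ''len'') (Read ''cnt'' (Reg ''c'')),
           Write ''end1'' (Reg ''len'') (Reg ''w''),
           Write ''end2'' (Reg ''len'') (Reg ''c''),
           incr ''len'']),
      incr ''w''])"

definition cover_program :: com where
  "cover_program = block
     [build_adjacency,
      Assign ''cover'' (Const 1),
      cover_all,
      Branch (Equal (Reg ''cover'') (Const 1))
        (block [Assign ''len'' (Const 0), Assign ''w'' (Const 0), list_edges])
        Skip]"

section \<open>The input graph\<close>

locale input_graph =
  fixes n :: nat and E :: "nat set set" and es :: "(nat \<times> nat) list" and k :: nat
  assumes simple: "simple_graph {..<n} E"
    and listing: "edge_listing E es"
    and k_ge_2: "2 \<le> k"
begin

definition nb :: "nat \<Rightarrow> nat set" where
  "nb u = {v. {u, v} \<in> E}"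

definition adjacency :: "state \<Rightarrow> bool" where
  "adjacency s \<longleftrightarrow> regs s ''n'' = n \<and> regs s ''k'' = k \<and>
     (\<forall>u<n. bij_betw (arrs s ''adj'') {arrs s ''start'' u..<arrs s ''start'' (Suc u)} (nb u))"

lemma edgeD:
  assumes "{u, v} \<in> E"
  shows "u < n" "v < n" "u \<noteq> v" "{v, u} \<in> E"
proof -
  obtain x y where "{u, v} = {x, y}" "x < n" "y < n" "x \<noteq> y"
    using assms simple unfolding simple_graph_def by blast
  then show "u < n" "v < n" "u \<noteq> v" by (auto simp: doubleton_eq_iff)
  show "{v, u} \<in> E" using assms by (simp add: insert_commute)
qed

lemma nb_iff: "v \<in> nb u \<longleftrightarrow> {u, v} \<in> E"
  by (simp add: nb_def)

lemma nb_subset: "nb u \<subseteq> {..<n}"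
  by (auto simp: nb_def edgeD)

lemma finite_nb [simp]: "finite (nb u)"
  using nb_subset finite_lessThan by (rule finite_subset)

lemma card_E: "card E = length es"
  using listing unfolding edge_listing_def by (metis distinct_card length_map)

lemma edge_at:
  assumes "j < length es"
  shows "{fst (es ! j), snd (es ! j)} \<in> E"
proof -
  have "(\<lambda>(u, v). {u, v}) (es ! j) \<in> E"
    using assms listing nth_mem[OF assms] unfolding edge_listing_def set_map by blast
  then show ?thesis by (simp add: case_prod_unfold)
qed

lemma edge_at_inj:
  assumes "i < length es" "j < length es"
    and "{fst (es ! i), snd (es ! i)} = {fst (es ! j), snd (es ! j)}"
  shows "i = j"
proof -
  have "distinct (map (\<lambda>(u, v). {u, v}) es)"
    using listing unfolding edge_listing_def by blast
  from nth_eq_iff_index_eq[OF this, of i j] assms show ?thesis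
    by (simp add: case_prod_unfold)
qed

lemma ex_edge_at:
  assumes "e \<in> E"
  obtains j where "j < length es" "e = {fst (es ! j), snd (es ! j)}"
proof -
  have "e \<in> set (map (\<lambda>(u, v). {u, v}) es)"
    using assms listing unfolding edge_listing_def by simp
  then obtain j where "j < length es" "e = (\<lambda>(u, v). {u, v}) (es ! j)"
    by (auto simp: in_set_conv_nth)
  then show ?thesis by (intro that) (simp_all add: case_prod_unfold)
qed

text \<open>
  The credit for visiting the nodes in \<open>X\<close>, and for looking once at all their neighbours.
\<close>

definition weight :: "nat set \<Rightarrow> nat" where
  "weight X = (\<Sum>u\<in>X. Suc (card (nb u)))"

text \<open>
  Every pair of adjacent nodes occurs in the list of edges, in one of its two orientations.
\<close>

lemma weight_all: "weight {..<n} \<le> n + 2 * length es"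
proof -
  let ?P = "Sigma {..<n} nb"
  have "?P \<subseteq> set es \<union> prod.swap ` set es"
  proof
    fix x assume "x \<in> ?P"
    then obtain u v where x: "x = (u, v)" and "{u, v} \<in> E" by (auto simp: nb_def)
    then obtain j where j: "j < length es" "{u, v} = {fst (es ! j), snd (es ! j)}"
      using ex_edge_at by blast
    then have "x = es ! j \<or> x = prod.swap (es ! j)"
      unfolding x by (cases "es ! j") (auto simp: doubleton_eq_iff)
    then show "x \<in> set es \<union> prod.swap ` set es" using j(1) by auto
  qed
  then have "card ?P \<le> card (set es \<union> prod.swap ` set es)"
    by (intro card_mono) auto
  also have "\<dots> \<le> card (set es) + card (prod.swap ` set es)" by (rule card_Un_le)
  also have "\<dots> \<le> length es + length es"
    by (intro add_mono card_length order_trans[OF card_image_le card_length]) simp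
  finally have "card ?P \<le> 2 * length es" by simp
  moreover have "card ?P = (\<Sum>u<n. card (nb u))" by (rule card_SigmaI) auto
  ultimately show ?thesis unfolding weight_def by (simp add: sum_Suc)
qed

lemma weight_remove:
  assumes "u \<in> X" "finite X"
  shows "weight X = Suc (card (nb u)) + weight (X - {u})"
  unfolding weight_def using assms by (simp add: sum.remove)

lemma adjacencyD:
  assumes "adjacency s" "u < n"
  shows "card (nb u) = arrs s ''start'' (Suc u) - arrs s ''start'' u"
    and "arrs s ''adj'' ` {arrs s ''start'' u..<arrs s ''start'' (Suc u)} = nb u"
    and "inj_on (arrs s ''adj'') {arrs s ''start'' u..<arrs s ''start'' (Suc u)}"
proof -
  have b: "bij_betw (arrs s ''adj'') {arrs s ''start'' u..<arrs s ''start'' (Suc u)} (nb u)"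
    using assms unfolding adjacency_def by blast
  from bij_betw_same_card[OF b] show "card (nb u) = arrs s ''start'' (Suc u) - arrs s ''start'' u"
    by simp
  from b show "arrs s ''adj'' ` {arrs s ''start'' u..<arrs s ''start'' (Suc u)} = nb u"
    and "inj_on (arrs s ''adj'') {arrs s ''start'' u..<arrs s ''start'' (Suc u)}"
    by (simp_all add: bij_betw_def)
qed

section \<open>Adjacency lists\<close>

lemma bij_betw_extend:
  assumes "bij_betw f {a..<p} A" "x \<notin> A" "a \<le> p"
  shows "bij_betw (f(p := x)) {a..<Suc p} (insert x A)"
proof -
  have eq: "{a..<Suc p} = insert p {a..<p}" using assms(3) by auto
  have "bij_betw (f(p := x)) {a..<p} A"
    using assms(1) by (subst bij_betw_cong[where g = f]) auto
  then show ?thesis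
    unfolding eq using assms(2) by (auto simp: bij_betw_def)
qed

definition seen :: "nat \<Rightarrow> nat \<Rightarrow> nat set" where
  "seen u j = {v. \<exists>i<j. {fst (es ! i), snd (es ! i)} = {u, v}}"

lemma seen_Suc:
  assumes "j < length es" "es ! j = (x, y)"
  shows "seen u (Suc j) =
    (if x = u then insert y (seen u j) else if y = u then insert x (seen u j) else seen u j)"
proof -
  have "seen u (Suc j) = seen u j \<union> {v. {fst (es ! j), snd (es ! j)} = {u, v}}"
    unfolding seen_def less_Suc_eq by blast
  also have "{v. {fst (es ! j), snd (es ! j)} = {u, v}} =
      (if x = u then {y} else if y = u then {x} else {})"
    using assms(2) by (auto simp: doubleton_eq_iff)
  finally show ?thesis by simp
qed

text \<open>
  No edge is listed twice, hence adjacency lists have no repetitions. This makes the number of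
  steps spent on them a degree, and keeps the queue of the search free of repetitions.
\<close>

lemma seen_new:
  assumes "j < length es" "{fst (es ! j), snd (es ! j)} = {u, v}"
  shows "v \<notin> seen u j"
proof
  assume "v \<in> seen u j"
  then obtain i where "i < j" "{fst (es ! i), snd (es ! i)} = {u, v}"
    unfolding seen_def by blast
  then show False using edge_at_inj[of i j] assms by simp
qed

lemma seen_all: "seen u (length es) = nb u"
  unfolding seen_def nb_def by (metis edge_at ex_edge_at)

definition has_input :: "state \<Rightarrow> bool" where
  "has_input s \<longleftrightarrow> regs s ''n'' = n \<and> regs s ''m'' = length es \<and> regs s ''k'' = k \<and>
     (\<forall>j<length es. (arrs s ''src'' j, arrs s ''dst'' j) = es ! j)"

text \<open>
  The lists of the earlier nodes lie below the old value of \<open>p\<close>, hence they survive.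
\<close>

lemma scan_edges:
  assumes "has_input s" "regs s ''j'' = 0"
  shows "wp scan_edges (\<lambda>t s'. t \<le> 40 * length es + 10 \<and>
    regs s ''p'' \<le> regs s' ''p'' \<and>
    (\<forall>i<regs s ''p''. arrs s' ''adj'' i = arrs s ''adj'' i) \<and>
    bij_betw (arrs s' ''adj'') {regs s ''p''..<regs s' ''p''} (nb (regs s ''u''))) s"
proof -
  define u where "u = regs s ''u''"
  define I where "I \<phi> s' \<longleftrightarrow> \<phi> = 40 * (length es - regs s' ''j'') \<and> regs s' ''j'' \<le> length es \<and>
    regs s ''p'' \<le> regs s' ''p'' \<and>
    (\<forall>i<regs s ''p''. arrs s' ''adj'' i = arrs s ''adj'' i) \<and>
    bij_betw (arrs s' ''adj'') {regs s ''p''..<regs s' ''p''} (seen u (regs s' ''j''))"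
    for \<phi> and s' :: state
  show ?thesis
    unfolding scan_edges_def
  proof (rule wp_While[where I = I and \<phi> = "40 * length es"], goal_cases)
    case 1
    show ?case unfolding I_def using assms by (simp add: seen_def bij_betw_def)
  next
    case (2 \<phi> s')
    have eqs: "regs s' ''m'' = length es" "regs s' ''u'' = u" "arrs s' ''src'' = arrs s ''src''"
      "arrs s' ''dst'' = arrs s ''dst''"
      using 2(2) assms(1) by (auto simp: frame_def has_input_def u_def)
    obtain x y where xy: "es ! regs s' ''j'' = (x, y)" by fastforce
    have j: "regs s' ''j'' < length es" using 2(3) eqs by simp
    then have rd: "arrs s ''src'' (regs s' ''j'') = x" "arrs s ''dst'' (regs s' ''j'') = y"
      using assms(1) xy unfolding has_input_def by force+
    have new: "x = u \<Longrightarrow> y \<notin> seen u (regs s' ''j'')" "y = u \<Longrightarrow> x \<notin> seen u (regs s' ''j'')"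
      using seen_new[OF j] xy by (auto simp: insert_commute)
    show ?case
      using 2(1) j new unfolding I_def
      by (auto simp: eqs rd seen_Suc[OF j xy] bij_betw_extend simp flip: u_def)
  next
    case (3 \<phi> t s')
    have "regs s' ''m'' = length es" using 3(2) assms(1) by (simp add: frame_def has_input_def)
    with 3 show ?case
      unfolding I_def seen_all[symmetric] u_def by auto
  qed
qed

lemma build_adjacency:
  assumes "has_input s" "regs s ''u'' = 0" "regs s ''p'' = 0" "arrs s ''start'' 0 = 0"
  shows "wp build_adjacency (\<lambda>t s'. t \<le> n * (40 * length es + 40) + 10 \<and> adjacency s') s"
proof -
  define I where "I \<phi> s' \<longleftrightarrow>
    \<phi> = (n - regs s' ''u'') * (40 * length es + 40) \<and> regs s' ''u'' \<le> n \<and>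
    regs s' ''p'' = arrs s' ''start'' (regs s' ''u'') \<and>
    (\<forall>x\<le>regs s' ''u''. arrs s' ''start'' x \<le> regs s' ''p'') \<and>
    (\<forall>x<regs s' ''u''.
      bij_betw (arrs s' ''adj'') {arrs s' ''start'' x..<arrs s' ''start'' (Suc x)} (nb x))"
    for \<phi> and s' :: state
  show ?thesis
    unfolding build_adjacency_def
  proof (rule wp_While[where I = I and \<phi> = "n * (40 * length es + 40)"], goal_cases)
    case 1
    show ?case unfolding I_def using assms by simp
  next
    case (2 \<phi> s')
    let ?s = "set_reg ''j'' 0 s'"
    have inp: "has_input s'" using 2(2) assms(1)
      by (auto simp: frame_def has_input_def scan_edges_def)
    then have "has_input ?s" by (simp add: has_input_def)
    have less: "regs s' ''u'' < n" using 2(3) inp by (simp add: has_input_def)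
    have main: "\<exists>\<phi>'. I \<phi>' (set_cell ''start'' (Suc (regs s'' ''u'')) (regs s'' ''p'')
          (set_reg ''u'' (Suc (regs s'' ''u'')) s'')) \<and> t + 25 + \<phi>' \<le> \<phi>"
      if t: "t \<le> 40 * length es + 10" and p: "regs s' ''p'' \<le> regs s'' ''p''"
        and old: "\<forall>i<regs s' ''p''. arrs s'' ''adj'' i = arrs s' ''adj'' i"
        and new: "bij_betw (arrs s'' ''adj'') {regs s' ''p''..<regs s'' ''p''} (nb (regs s' ''u''))"
        and fr: "regs s'' ''u'' = regs s' ''u''" "arrs s'' ''start'' = arrs s' ''start''"
      for t s''
    proof -
      let ?u = "regs s' ''u''" and ?st = "arrs s' ''start''"
      let ?st' = "?st(Suc ?u := regs s'' ''p'')"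
      have I: "regs s' ''p'' = ?st ?u" "\<forall>x\<le>?u. ?st x \<le> regs s' ''p''"
        "\<forall>x<?u. bij_betw (arrs s' ''adj'') {?st x..<?st (Suc x)} (nb x)"
        "\<phi> = (n - ?u) * (40 * length es + 40)"
        using 2(1) by (auto simp: I_def)
      have "\<forall>x\<le>Suc ?u. ?st' x \<le> regs s'' ''p''"
        using I(2) p by (fastforce simp: le_Suc_eq)
      moreover have "bij_betw (arrs s'' ''adj'') {?st' x..<?st' (Suc x)} (nb x)" if "x < Suc ?u" for x
      proof (cases "x = ?u")
        case True
        then show ?thesis using new I(1) by simp
      next
        case False
        then have x: "x < ?u" using that by simp
        then have "?st (Suc x) \<le> regs s' ''p''" using I(2) by simp
        then have "bij_betw (arrs s'' ''adj'') {?st x..<?st (Suc x)} (nb x)"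
          using I(3) x old by (subst bij_betw_cong[where g = "arrs s' ''adj''"]) auto
        then show ?thesis using x by simp
      qed
      moreover have "\<phi> = 40 * length es + 40 + (n - Suc ?u) * (40 * length es + 40)"
      proof -
        have "n - ?u = Suc (n - Suc ?u)" using less by simp
        then show ?thesis unfolding I(4) by simp
      qed
      ultimately show ?thesis using less t by (auto simp: I_def fr)
    qed
    have "wp scan_edges (\<lambda>t s''. t \<le> 40 * length es + 10 \<and>
      regs ?s ''p'' \<le> regs s'' ''p'' \<and>
      (\<forall>i<regs ?s ''p''. arrs s'' ''adj'' i = arrs ?s ''adj'' i) \<and>
      bij_betw (arrs s'' ''adj'') {regs ?s ''p''..<regs s'' ''p''} (nb (regs ?s ''u''))) ?s"
      by (rule scan_edges) (use \<open>has_input ?s\<close> in auto)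
    then show ?case
      apply simp
      apply (erule wp_conseq)
      subgoal for t s''
        using main[of t s''] by (fastforce simp: frame_def scan_edges_def)
      done
  next
    case (3 \<phi> t s')
    have "regs s' ''n'' = n" "regs s' ''k'' = k" using 3(2) assms(1)
      by (auto simp: frame_def has_input_def scan_edges_def)
    with 3 show ?case
      unfolding I_def adjacency_def by auto
  qed
qed

end

section \<open>Star systems\<close>

context input_graph
begin

definition leaves :: "(nat \<Rightarrow> nat) \<Rightarrow> nat \<Rightarrow> nat set" where
  "leaves par c = {w. w < n \<and> par w = Suc c}"

text \<open>
  While a path is being shifted, the counter of one centre is ahead of its leaves by one, in
  anticipation of the leaf about to be attached. \<open>D\<close> is the set of such centres. Centres are
  not leaves, so the stars are disjoint.
\<close>

definition star_system :: "(nat \<Rightarrow> nat) \<Rightarrow> (nat \<Rightarrow> nat) \<Rightarrow> nat set \<Rightarrow> bool" where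
  "star_system par cnt D \<longleftrightarrow>
     (\<forall>w<n. \<forall>c. par w = Suc c \<longrightarrow> {w, c} \<in> E \<and> par c = 0) \<and>
     (\<forall>c<n. cnt c = card (leaves par c) + of_bool (c \<in> D) \<and> cnt c \<le> k)"

lemma finite_leaves [simp]: "finite (leaves par c)"
  by (simp add: leaves_def)

lemma star_systemD:
  assumes "star_system par cnt D"
  shows "w < n \<Longrightarrow> par w = Suc c \<Longrightarrow> {w, c} \<in> E"
    and "w < n \<Longrightarrow> par w = Suc c \<Longrightarrow> c < n"
    and "w < n \<Longrightarrow> par w = Suc c \<Longrightarrow> par c = 0"
    and "c < n \<Longrightarrow> cnt c = card (leaves par c) + of_bool (c \<in> D)"
    and "c < n \<Longrightarrow> cnt c \<le> k"
  using assms edgeD unfolding star_system_def by blast+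

lemma star_system_leaves:
  assumes "star_system par cnt D"
  shows "leaves par c \<subseteq> nb c"
  using star_systemD(1)[OF assms] by (auto simp: leaves_def nb_def insert_commute)

lemma no_leaves:
  assumes "star_system par cnt D" "c < n" "par c \<noteq> 0 \<or> cnt c = 0"
  shows "leaves par c = {}"
  using assms(3)
proof
  assume "par c \<noteq> 0"
  then show ?thesis using star_systemD(3)[OF assms(1)] by (auto simp: leaves_def)
next
  assume "cnt c = 0"
  then show ?thesis using star_systemD(4)[OF assms(1,2)] by simp
qed

text \<open>
  Moving \<open>a\<close> affects the old and the new centre only. Stated additively, so that the case in
  which the two coincide, or in which one of them does not exist, needs no distinction.
\<close>

lemma card_leaves_update:
  assumes "a < n"
  shows "card (leaves (par(a := y)) c) + of_bool (par a = Suc c) =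
    card (leaves par c) + of_bool (y = Suc c)"
proof -
  have remove: "card (leaves p c) = card (leaves p c - {a}) + of_bool (p a = Suc c)" for p
  proof (cases "p a = Suc c")
    case True
    then have "a \<in> leaves p c" using assms by (simp add: leaves_def)
    then show ?thesis using True card.remove[OF finite_leaves] by simp
  next
    case False
    then have "leaves p c - {a} = leaves p c" by (auto simp: leaves_def)
    then show ?thesis using False by simp
  qed
  have "leaves (par(a := y)) c - {a} = leaves par c - {a}"
    by (auto simp: leaves_def)
  then show ?thesis using remove[of "par(a := y)"] remove[of par] by simp
qed

lemma star_system_promise:
  assumes "star_system par cnt {}" "cnt t < k"
  shows "star_system par (cnt(t := Suc (cnt t))) {t}"
  using assms unfolding star_system_def by auto

lemma star_system_detach:
  assumes st: "star_system par cnt {}" and "v < n" "par v = Suc c"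
  shows "star_system (par(v := 0)) (cnt(c := cnt c - 1)) {}"
proof -
  have "(cnt(c := cnt c - 1)) x = card (leaves (par(v := 0)) x) + of_bool (x \<in> {}) \<and>
      (cnt(c := cnt c - 1)) x \<le> k"
    if "x < n" for x
    using card_leaves_update[of v par 0 x] star_systemD(4,5)[OF st that] assms(2,3) by auto
  moreover have "{w, d} \<in> E \<and> (par(v := 0)) d = 0"
    if "w < n" "(par(v := 0)) w = Suc d" for w d
    using that star_systemD(1,3)[OF st, of w d] by (auto split: if_splits)
  ultimately show ?thesis unfolding star_system_def by blast
qed

text \<open>
  Attaching \<open>a\<close> to \<open>t\<close> honours the promise made at \<open>t\<close>. If \<open>a\<close> was a leaf before, its old
  centre has lost a leaf that its counter still includes, and so becomes the next centre with
  a promise. This is one step of the shift along the path, and also its end, where \<open>a\<close> is the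
  root.
\<close>

lemma star_system_attach:
  assumes st: "star_system par cnt {t}" and "{a, t} \<in> E" "par t = 0" "leaves par a = {}"
  shows "star_system (par(a := Suc t)) cnt {c. par a = Suc c}"
proof -
  have a: "a < n" "a \<noteq> t" using assms(2) edgeD by blast+
  have "cnt x = card (leaves (par(a := Suc t)) x) + of_bool (x \<in> {c. par a = Suc c}) \<and>
      cnt x \<le> k"
    if "x < n" for x
    using card_leaves_update[of a par "Suc t" x] star_systemD(4,5)[OF st that] a(1) by auto
  moreover have "{w, d} \<in> E \<and> (par(a := Suc t)) d = 0"
    if "w < n" "(par(a := Suc t)) w = Suc d" for w d
    using that star_systemD(1,3)[OF st, of w d] assms(2-4) a
    by (auto simp: leaves_def split: if_splits)
  ultimately show ?thesis unfolding star_system_def by blast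
qed

text \<open>
  The search tree: \<open>node\<close> lists the \<open>len\<close> outer nodes in the order of their discovery, and
  \<open>pred\<close> maps each marked centre to the outer node from which it was reached. That node precedes
  all leaves of the centre, so following \<open>par\<close> and \<open>pred\<close> decreases the position in the list.
\<close>

definition search_inv ::
  "nat \<Rightarrow> (nat \<Rightarrow> nat) \<Rightarrow> (nat \<Rightarrow> nat) \<Rightarrow> (nat \<Rightarrow> nat) \<Rightarrow> (nat \<Rightarrow> nat) \<Rightarrow>
   (nat \<Rightarrow> nat) \<Rightarrow> nat \<Rightarrow> bool" where
  "search_inv r par cnt mark pred node len \<longleftrightarrow>
     0 < len \<and> node 0 = r \<and> inj_on node {..<len} \<and>
     (\<forall>j<len. 0 < j \<longrightarrow> node j < n \<and> (\<exists>c i. par (node j) = Suc c \<and> c < n \<and> mark c = Suc r \<and>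
        i < j \<and> pred c = node i \<and> {node i, c} \<in> E)) \<and>
     (\<forall>c<n. mark c = Suc r \<longrightarrow> par c = 0 \<and> cnt c = k \<and> leaves par c \<subseteq> node ` {..<len})"

lemma search_inv_path:
  assumes "search_inv r par cnt mark pred node len" "j < len" "par (node j) = Suc c"
    "par r = 0"
  obtains i where "c < n" "mark c = Suc r" "i < j" "pred c = node i" "{node i, c} \<in> E"
proof -
  have "j \<noteq> 0" using assms unfolding search_inv_def by (metis Zero_not_Suc)
  then obtain d i where "par (node j) = Suc d" "d < n" "mark d = Suc r" "i < j"
      "pred d = node i" "{node i, d} \<in> E"
    using assms(1,2) unfolding search_inv_def by blast
  then show ?thesis using assms(3) that by simp
qed

text \<open>
  The root has no leaves, and all other outer nodes are leaves themselves.
\<close>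

lemma search_inv_not_full:
  assumes "search_inv r par cnt mark pred node len" "j < len" "cnt r = 0" "par r = 0"
  shows "\<not> (par (node j) = 0 \<and> cnt (node j) = k)"
proof (cases "j = 0")
  case True
  then have "node j = r" using assms(1) unfolding search_inv_def by blast
  then show ?thesis using assms(3) k_ge_2 by simp
next
  case False
  then obtain c where "par (node j) = Suc c"
    using assms(1,2) unfolding search_inv_def by blast
  then show ?thesis by simp
qed

lemma search_inv_full:
  assumes "search_inv r par cnt mark pred node len" "c < n" "mark c = Suc r"
  shows "par c = 0" "cnt c = k"
  using assms unfolding search_inv_def by blast+

lemma search_inv_init:
  assumes "\<forall>c<n. mark c \<le> r" "node 0 = r"
  shows "search_inv r par cnt mark pred node 1"
  using assms unfolding search_inv_def by (auto simp: lessThan_Suc)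

lemma search_inv_expand:
  assumes inv: "search_inv r par cnt mark pred node len"
    and edge: "{node i, v} \<in> E" and i: "i < len" and full: "par v = 0" "cnt v = k"
    and new: "mark v \<noteq> Suc r" and r: "par r = 0"
    and old: "\<forall>j<len. node' j = node j" and len: "len \<le> len'"
    and push: "bij_betw node' {len..<len'} (leaves par v)"
  shows "search_inv r par cnt (mark(v := Suc r)) (pred(v := node i)) node' len'"
proof -
  have v: "v < n" using edge edgeD by blast
  have split: "{..<len'} = {..<len} \<union> {len..<len'}" using len by auto
  have inj: "inj_on node {..<len}" and len0: "0 < len" and root: "node 0 = r"
    using inv unfolding search_inv_def by blast+
  have im: "node' ` {..<len} = node ` {..<len}" using old by auto
  have im': "node' ` {..<len'} = node ` {..<len} \<union> leaves par v"
    unfolding split image_Un im using push by (simp add: bij_betw_def)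
  have disj: "par w \<noteq> Suc v" if "w \<in> node ` {..<len}" for w
    using that search_inv_path[OF inv _ _ r] new by blast
  have "inj_on node' {..<len'}"
    unfolding split inj_on_Un
  proof (intro conjI)
    show "inj_on node' {..<len}" using inj old by (simp add: inj_on_def)
    show "inj_on node' {len..<len'}" using push by (simp add: bij_betw_def)
    have "node' ` {len..<len'} = leaves par v" using push by (simp add: bij_betw_def)
    then have "node' ` {..<len} \<inter> node' ` {len..<len'} = {}"
      unfolding im using disj by (auto simp: leaves_def)
    then show "node' ` ({..<len} - {len..<len'}) \<inter> node' ` ({len..<len'} - {..<len}) = {}"
      by blast
  qed
  moreover have "node' j < n \<and> (\<exists>c i'. par (node' j) = Suc c \<and> c < n \<and>
      (mark(v := Suc r)) c = Suc r \<and> i' < j \<and> (pred(v := node i)) c = node' i' \<and>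
      {node' i', c} \<in> E)" if j: "j < len'" "0 < j" for j
  proof (cases "j < len")
    case True
    then obtain c i' where "node j < n" "par (node j) = Suc c" "c < n" "mark c = Suc r" "i' < j"
      "pred c = node i'" "{node i', c} \<in> E"
      using inv j(2) unfolding search_inv_def by blast
    moreover have "c \<noteq> v" using calculation new by blast
    ultimately show ?thesis using True old by (auto intro!: exI[of _ i'])
  next
    case False
    then have "node' j \<in> leaves par v" using push j(1) by (auto simp: bij_betw_def)
    moreover have "i < j" using i False by simp
    ultimately show ?thesis using v edge i old by (auto simp: leaves_def intro!: exI[of _ i])
  qed
  moreover have "par c = 0 \<and> cnt c = k \<and> leaves par c \<subseteq> node' ` {..<len'}"
    if c: "c < n" "(mark(v := Suc r)) c = Suc r" for c
  proof (cases "c = v")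
    case True
    then show ?thesis using full im' by simp
  next
    case False
    then have "par c = 0 \<and> cnt c = k \<and> leaves par c \<subseteq> node ` {..<len}"
      using inv c unfolding search_inv_def by auto
    then show ?thesis using im' by blast
  qed
  moreover have "0 < len'" "node' 0 = r" using len0 root old len by auto
  ultimately show ?thesis unfolding search_inv_def by blast
qed

text \<open>
  The case of a failed search. The leaves of the marked centres are \<open>k\<close> for each neighbour of
  the outer nodes, and all of them are outer nodes different from the root.
\<close>

lemma search_inv_violator:
  assumes inv: "search_inv r par cnt mark pred node len" and st: "star_system par cnt {}"
    and r: "r < n" "par r = 0" "cnt r = 0"
    and processed: "\<forall>j<len. \<forall>y\<in>nb (node j). mark y = Suc r"
  shows "stable_set {..<n} E (node ` {..<len})"
    and "card (node ` {..<len}) > k * card (nbhd {..<n} E (node ` {..<len}))"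
proof -
  let ?S = "node ` {..<len}"
  define M where "M = {c. c < n \<and> mark c = Suc r}"
  have nodes: "?S \<subseteq> {..<n}"
    using inv r(1) unfolding search_inv_def by (metis image_subsetI lessThan_iff not_gr_zero)
  have nbM: "v \<in> M" if "u \<in> ?S" "{u, v} \<in> E" for u v
    using that processed edgeD unfolding M_def nb_def by blast
  have notM: "u \<notin> M" if "u \<in> ?S" for u
    using that search_inv_not_full[OF inv _ r(3,2)] search_inv_full[OF inv] unfolding M_def by blast
  show "stable_set {..<n} E ?S"
    unfolding stable_set_def using nodes nbM notM by blast
  have fin: "finite M" unfolding M_def by simp
  have root: "r \<in> ?S" using inv unfolding search_inv_def by blast
  have "k * card (nbhd {..<n} E ?S) \<le> k * card M"
    by (rule mult_le_mono2, rule card_mono[OF fin]) (use nbM in \<open>auto simp: nbhd_def\<close>)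
  also have "\<dots> = (\<Sum>c\<in>M. card (leaves par c))"
  proof -
    have "card (leaves par c) = k" if "c \<in> M" for c
      using that search_inv_full[OF inv] star_systemD(4)[OF st] unfolding M_def by auto
    then show ?thesis by simp
  qed
  also have "\<dots> = card (\<Union>c\<in>M. leaves par c)"
    by (rule card_UN_disjoint[symmetric]) (use fin in \<open>auto simp: leaves_def\<close>)
  also have "\<dots> \<le> card (?S - {r})"
  proof (rule card_mono)
    show "(\<Union>c\<in>M. leaves par c) \<subseteq> ?S - {r}"
      using inv r(2) unfolding search_inv_def M_def leaves_def by fastforce
  qed simp
  also have "\<dots> < card ?S" using root by (intro card_Diff1_less) auto
  finally show "card ?S > k * card (nbhd {..<n} E ?S)" .
qed

end

section \<open>The search for an augmentation\<close>

context input_graph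
begin

text \<open>
  The cost is proportional to the degree of \<open>v\<close>, which is the credit that marking \<open>v\<close> releases.
\<close>

lemma push_leaves:
  assumes adj: "adjacency s" and v: "regs s ''v'' < n"
    and q: "regs s ''q'' = arrs s ''start'' (regs s ''v'')"
  shows "wp push_leaves (\<lambda>t s'. t \<le> 40 * card (nb (regs s ''v'')) + 20 \<and>
    regs s ''len'' \<le> regs s' ''len'' \<and>
    (\<forall>j<regs s ''len''. arrs s' ''node'' j = arrs s ''node'' j) \<and>
    bij_betw (arrs s' ''node'') {regs s ''len''..<regs s' ''len''}
      {w \<in> nb (regs s ''v''). arrs s ''par'' w = Suc (regs s ''v'')}) s"
proof -
  define v where "v = regs s ''v''"
  define a e where "a = arrs s ''start'' v" and "e = arrs s ''start'' (Suc v)"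
  define adj where "adj = arrs s ''adj''"
  define par where "par = arrs s ''par''"
  define len where "len = regs s ''len''"
  have nb: "adj ` {a..<e} = nb v" "inj_on adj {a..<e}" "card (nb v) = e - a"
    using adjacencyD[OF assms(1)] assms(2) unfolding adj_def a_def e_def v_def by blast+
  define I where "I \<phi> s' \<longleftrightarrow> \<phi> = 40 * (e - regs s' ''q'') \<and> a \<le> regs s' ''q'' \<and>
    {a..<regs s' ''q''} \<subseteq> {a..<e} \<and> len \<le> regs s' ''len'' \<and>
    (\<forall>j<len. arrs s' ''node'' j = arrs s ''node'' j) \<and>
    bij_betw (arrs s' ''node'') {len..<regs s' ''len''}
      {w \<in> adj ` {a..<regs s' ''q''}. par w = Suc v}"
    for \<phi> and s' :: state
  show ?thesis
    unfolding push_leaves_def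
  proof (rule wp_While[where I = I and \<phi> = "40 * (e - a)"], goal_cases)
    case 1
    show ?case unfolding I_def using q by (simp add: bij_betw_def a_def v_def len_def)
  next
    case (2 \<phi> s')
    let ?q = "regs s' ''q''"
    have eqs: "regs s' ''v'' = v" "arrs s' ''start'' = arrs s ''start''"
      "arrs s' ''adj'' = adj" "arrs s' ''par'' = par"
      using 2(2) by (simp_all add: frame_def v_def adj_def par_def)
    have less: "?q < e" using 2(3) eqs by (simp add: e_def)
    have aq: "a \<le> ?q" using 2(1) by (simp add: I_def)
    have range: "{a..<Suc ?q} = insert ?q {a..<?q}" using aq by auto
    have fresh: "adj ?q \<notin> adj ` {a..<?q}"
    proof
      assume "adj ?q \<in> adj ` {a..<?q}"
      then obtain x where "x \<in> {a..<?q}" "adj ?q = adj x" by blast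
      moreover then have "x = ?q" using nb(2) less aq by (auto dest!: inj_onD)
      ultimately show False by simp
    qed
    have set: "{w \<in> adj ` {a..<Suc ?q}. par w = Suc v} =
      (if par (adj ?q) = Suc v then insert (adj ?q) {w \<in> adj ` {a..<?q}. par w = Suc v}
       else {w \<in> adj ` {a..<?q}. par w = Suc v})"
      unfolding range by auto
    have "{a..<Suc ?q} \<subseteq> {a..<e}" using less by auto
    then show ?case
      using 2(1) less fresh unfolding I_def
      by (auto simp: eqs set bij_betw_extend)
  next
    case (3 \<phi> t s')
    have "regs s' ''v'' = v" "arrs s' ''start'' = arrs s ''start''"
      using 3(2) by (simp_all add: frame_def v_def)
    with 3(3) have "e \<le> regs s' ''q''" by (simp add: e_def)
    then have "{a..<regs s' ''q''} = {a..<e}" using 3(1) by (auto simp: I_def)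
    then have "adj ` {a..<regs s' ''q''} = nb v" using nb(1) by simp
    then show ?case
      using 3(1,4) nb(3) unfolding I_def by (simp add: v_def len_def par_def)
  qed
qed

text \<open>
  Marks never exceed \<open>r + 1\<close>, so that no node is marked when the search from \<open>r + 1\<close> begins.
\<close>

definition searching :: "state \<Rightarrow> bool" where
  "searching s \<longleftrightarrow> adjacency s \<and> star_system (arrs s ''par'') (arrs s ''cnt'') {} \<and>
     regs s ''r'' < n \<and> arrs s ''par'' (regs s ''r'') = 0 \<and> arrs s ''cnt'' (regs s ''r'') = 0 \<and>
     (\<forall>c<n. arrs s ''mark'' c \<le> Suc (regs s ''r'')) \<and>
     search_inv (regs s ''r'') (arrs s ''par'') (arrs s ''cnt'') (arrs s ''mark'')
       (arrs s ''pred'') (arrs s ''node'') (regs s ''len'')"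

lemma searching_node:
  assumes "searching s" "j < regs s ''len''"
  shows "arrs s ''node'' j < n"
  using assms unfolding searching_def search_inv_def by (cases "j = 0") auto

definition marked :: "state \<Rightarrow> nat set" where
  "marked s = {c. c < n \<and> arrs s ''mark'' c = Suc (regs s ''r'')}"

definition full :: "state \<Rightarrow> nat \<Rightarrow> bool" where
  "full s c \<longleftrightarrow> arrs s ''par'' c = 0 \<and> arrs s ''cnt'' c = k"

definition extends :: "state \<Rightarrow> state \<Rightarrow> bool" where
  "extends s s' \<longleftrightarrow> regs s ''len'' \<le> regs s' ''len'' \<and>
     (\<forall>j<regs s ''len''. arrs s' ''node'' j = arrs s ''node'' j) \<and> marked s \<subseteq> marked s'"

lemma extends_trans: "extends s s' \<Longrightarrow> extends s' s'' \<Longrightarrow> extends s s''"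
  unfolding extends_def by auto

text \<open>
  Each centre is marked at most once during a search, and its expansion is paid for in advance.
\<close>

abbreviation credit :: "state \<Rightarrow> nat" where
  "credit s \<equiv> 100 * weight ({..<n} - marked s)"

lemma visit_neighbour:
  assumes S: "searching s" and i: "i < regs s ''len''"
    and u: "regs s ''u'' = arrs s ''node'' i"
    and v: "v \<in> nb (regs s ''u'')" and vp: "arrs s ''adj'' (regs s ''p'') = v"
    and found: "regs s ''found'' = 0"
  shows "wp visit_neighbour (\<lambda>t s'. searching s' \<and> extends s s' \<and> t + credit s' \<le> 80 + credit s \<and>
       regs s' ''p'' = Suc (regs s ''p'') \<and>
       (regs s' ''found'' = 0 \<and> v \<in> marked s' \<or>
        regs s' ''found'' = 1 \<and> regs s' ''v'' = v \<and> \<not> full s' v)) s"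
proof -
  have vn: "v < n" using v nb_subset by blast
  have k: "regs s ''k'' = k" using S unfolding searching_def adjacency_def by blast
  consider "\<not> full s v" | "full s v" "v \<in> marked s" | "full s v" "v \<notin> marked s" by blast
  then show ?thesis
  proof cases
    case 1
    then show ?thesis
      using S vp k unfolding visit_neighbour_def searching_def extends_def marked_def full_def
        adjacency_def
      by (auto simp: vp)
  next
    case 2
    then show ?thesis
      using S vp k found unfolding visit_neighbour_def searching_def extends_def marked_def full_def
        adjacency_def
      by (simp add: vp)
  next
    case 3
    let ?r = "regs s ''r''"
    define s1 where "s1 = set_reg ''q'' (arrs s ''start'' v) (set_cell ''pred'' v (regs s ''u'')
      (set_cell ''mark'' v (Suc ?r) (set_reg ''v'' v s)))"
    have s1: "regs s1 ''v'' = v" "regs s1 ''len'' = regs s ''len''" "regs s1 ''q'' = arrs s ''start'' v"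
      "arrs s1 ''node'' = arrs s ''node''" "arrs s1 ''par'' = arrs s ''par''"
      "arrs s1 ''cnt'' = arrs s ''cnt''" "arrs s1 ''start'' = arrs s ''start''"
      "arrs s1 ''adj'' = arrs s ''adj''"
      "arrs s1 ''mark'' = (arrs s ''mark'')(v := Suc ?r)"
      "arrs s1 ''pred'' = (arrs s ''pred'')(v := regs s ''u'')"
      "regs s1 ''r'' = ?r" "regs s1 ''n'' = regs s ''n''" "regs s1 ''k'' = regs s ''k''"
      "regs s1 ''p'' = regs s ''p''" "regs s1 ''found'' = 0" "regs s1 ''u'' = regs s ''u''"
      by (simp_all add: s1_def found)
    have adj1: "adjacency s1" using S unfolding searching_def adjacency_def s1 by blast
    have new: "arrs s ''mark'' v \<noteq> Suc ?r" using 3(2) vn unfolding marked_def by simp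
    have main: "searching s' \<and> extends s s' \<and> t + 60 + credit s' \<le> 80 + credit s \<and> v \<in> marked s'"
      if t: "t \<le> 40 * card (nb v) + 20" and len: "regs s ''len'' \<le> regs s2 ''len''"
        and old: "\<forall>j<regs s ''len''. arrs s2 ''node'' j = arrs s ''node'' j"
        and push: "bij_betw (arrs s2 ''node'') {regs s ''len''..<regs s2 ''len''}
          {w \<in> nb v. arrs s ''par'' w = Suc v}"
        and fr: "frame push_leaves s1 s2"
        and s': "s' = set_reg ''p'' (Suc (regs s2 ''p'')) s2"
      for t s2 s'
    proof -
      have s2: "arrs s' ''par'' = arrs s ''par''" "arrs s' ''cnt'' = arrs s ''cnt''"
        "arrs s' ''start'' = arrs s ''start''" "arrs s' ''adj'' = arrs s ''adj''"
        "arrs s' ''mark'' = (arrs s ''mark'')(v := Suc ?r)"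
        "arrs s' ''pred'' = (arrs s ''pred'')(v := arrs s ''node'' i)"
        "regs s' ''r'' = ?r" "regs s' ''n'' = regs s ''n''" "regs s' ''k'' = regs s ''k''"
        "regs s' ''len'' = regs s2 ''len''" "arrs s' ''node'' = arrs s2 ''node''"
        using fr s1 u by (simp_all add: frame_def push_leaves_def s')
      have st: "star_system (arrs s ''par'') (arrs s ''cnt'') {}"
        using S unfolding searching_def by blast
      have "{w \<in> nb v. arrs s ''par'' w = Suc v} = leaves (arrs s ''par'') v"
        using star_system_leaves[OF st] nb_subset by (auto simp: leaves_def)
      then have "search_inv ?r (arrs s ''par'') (arrs s ''cnt'') ((arrs s ''mark'')(v := Suc ?r))
          ((arrs s ''pred'')(v := arrs s ''node'' i)) (arrs s2 ''node'') (regs s2 ''len'')"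
        using S 3(1) v u i new len old push unfolding searching_def full_def nb_iff
        by (intro search_inv_expand) auto
      then have "searching s'"
        using S unfolding searching_def adjacency_def s2 by simp
      moreover have m: "marked s' = insert v (marked s)"
        unfolding marked_def s2 using vn by auto
      moreover have "weight ({..<n} - marked s) = Suc (card (nb v)) + weight ({..<n} - marked s')"
      proof -
        have "{..<n} - marked s' = {..<n} - marked s - {v}" unfolding m by blast
        then show ?thesis using weight_remove[of v "{..<n} - marked s"] vn 3(2) by simp
      qed
      ultimately show ?thesis
        using t len old s2 unfolding extends_def by auto
    qed
    have "wp push_leaves (\<lambda>t s'. t \<le> 40 * card (nb (regs s1 ''v'')) + 20 \<and>
      regs s1 ''len'' \<le> regs s' ''len'' \<and>
      (\<forall>j<regs s1 ''len''. arrs s' ''node'' j = arrs s1 ''node'' j) \<and>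
      bij_betw (arrs s' ''node'') {regs s1 ''len''..<regs s' ''len''}
        {w \<in> nb (regs s1 ''v''). arrs s1 ''par'' w = Suc (regs s1 ''v'')}) s1"
      by (rule push_leaves) (use adj1 vn s1 in auto)
    then have "wp push_leaves (\<lambda>t s2. let s' = set_reg ''p'' (Suc (regs s2 ''p'')) s2 in
      searching s' \<and> extends s s' \<and> t + 60 + credit s' \<le> 80 + credit s \<and> v \<in> marked s' \<and>
      regs s2 ''p'' = regs s ''p'' \<and> regs s2 ''found'' = 0) s1"
    proof (rule wp_conseq, goal_cases)
      case (1 t s2)
      have "regs s2 ''p'' = regs s ''p''" "regs s2 ''found'' = 0"
        using 1(2) s1 by (simp_all add: frame_def push_leaves_def)
      then show ?case using main[OF _ _ _ _ 1(2) refl, of t] 1(1) unfolding s1 Let_def by blast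
    qed
    then show ?thesis
      using 3 new k unfolding full_def visit_neighbour_def
      apply (simp add: vp flip: s1_def)
      apply (erule wp_conseq)
      apply (auto simp: Let_def)
      done
  qed
qed

lemma scan_neighbours:
  assumes S: "searching s" and i: "i < regs s ''len''"
    and u: "regs s ''u'' = arrs s ''node'' i"
    and p: "regs s ''p'' = arrs s ''start'' (regs s ''u'')"
    and found: "regs s ''found'' = 0"
  shows "wp scan_neighbours (\<lambda>t s'. searching s' \<and> extends s s' \<and>
    t + credit s' \<le> 100 * card (nb (regs s ''u'')) + credit s + 20 \<and>
    (regs s' ''found'' = 0 \<and> nb (regs s ''u'') \<subseteq> marked s' \<or>
     regs s' ''found'' = 1 \<and> regs s' ''v'' \<in> nb (regs s ''u'') \<and> \<not> full s' (regs s' ''v''))) s"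
proof -
  define u where "u = regs s ''u''"
  define a e where "a = arrs s ''start'' u" and "e = arrs s ''start'' (Suc u)"
  define adj where "adj = arrs s ''adj''"
  have "u < n" using searching_node[OF S i] assms(3) by (simp add: u_def)
  then have nb: "adj ` {a..<e} = nb u" "card (nb u) = e - a"
    using adjacencyD(1,2)[of s u] S unfolding adj_def a_def e_def searching_def by blast+
  define I where "I \<phi> s' \<longleftrightarrow> \<phi> = 100 * (e - regs s' ''p'') + credit s' \<and>
    searching s' \<and> extends s s' \<and> a \<le> regs s' ''p'' \<and>
    (regs s' ''found'' = 0 \<and> {a..<regs s' ''p''} \<subseteq> {a..<e} \<and>
       adj ` {a..<regs s' ''p''} \<subseteq> marked s' \<or>
     regs s' ''found'' = 1 \<and> regs s' ''v'' \<in> nb u \<and> \<not> full s' (regs s' ''v''))"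
    for \<phi> and s' :: state
  show ?thesis
    unfolding scan_neighbours_def
  proof (rule wp_While[where I = I and \<phi> = "100 * (e - a) + credit s"], goal_cases)
    case 1
    show ?case unfolding I_def using S p found by (simp add: extends_def a_def u_def)
  next
    case (2 \<phi> s')
    let ?p = "regs s' ''p''"
    have eqs: "regs s' ''u'' = u" "arrs s' ''start'' = arrs s ''start''" "arrs s' ''adj'' = adj"
      using 2(2) by (simp_all add: frame_def visit_neighbour_def push_leaves_def u_def adj_def)
    have less: "?p < e" and found': "regs s' ''found'' = 0" using 2(3) eqs by (simp_all add: e_def)
    have I: "searching s'" "extends s s'" "a \<le> ?p" "adj ` {a..<?p} \<subseteq> marked s'"
      "\<phi> = 100 * (e - ?p) + credit s'"
      using 2(1) found' unfolding I_def by auto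
    have range: "{a..<Suc ?p} = insert ?p {a..<?p}" using I(3) by auto
    have "adj ?p \<in> nb u" unfolding nb(1)[symmetric] using I(3) less by simp
    moreover have "i < regs s' ''len''" "regs s' ''u'' = arrs s' ''node'' i"
      using I(2) i u eqs(1) unfolding extends_def u_def by auto
    ultimately have "wp visit_neighbour (\<lambda>t s''. searching s'' \<and> extends s' s'' \<and>
       t + credit s'' \<le> 80 + credit s' \<and> regs s'' ''p'' = Suc ?p \<and>
       (regs s'' ''found'' = 0 \<and> adj ?p \<in> marked s'' \<or>
        regs s'' ''found'' = 1 \<and> regs s'' ''v'' = adj ?p \<and> \<not> full s'' (adj ?p))) s'"
      using I(1) found' eqs by (intro visit_neighbour) auto
    then show ?case
    proof (rule wp_conseq, goal_cases)
      case (1 t s'')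
      then have Q: "searching s''" "extends s' s''" "t + credit s'' \<le> 80 + credit s'"
        "regs s'' ''p'' = Suc ?p"
        "regs s'' ''found'' = 0 \<and> adj ?p \<in> marked s'' \<or>
         regs s'' ''found'' = 1 \<and> regs s'' ''v'' = adj ?p \<and> \<not> full s'' (adj ?p)"
        by blast+
      have "{a..<Suc ?p} \<subseteq> {a..<e}" using less by auto
      moreover have "marked s' \<subseteq> marked s''" using Q(2) unfolding extends_def by blast
      ultimately have "I (100 * (e - Suc ?p) + credit s'') s''"
        unfolding I_def using Q extends_trans[OF I(2) Q(2)] I(3,4) \<open>adj ?p \<in> nb u\<close>
        by (auto simp: range)
      moreover have "e - ?p = Suc (e - Suc ?p)" using less by simp
      ultimately show ?case
        using Q(3) I(5) by (intro exI[of _ "100 * (e - Suc ?p) + credit s''"]) simp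
    qed
  next
    case (3 \<phi> t s')
    have eqs: "regs s' ''u'' = u" "arrs s' ''start'' = arrs s ''start''"
      using 3(2) by (simp_all add: frame_def visit_neighbour_def push_leaves_def u_def)
    have "nb u \<subseteq> marked s'" if "regs s' ''found'' = 0"
    proof -
      have "e \<le> regs s' ''p''" using 3(3) that eqs by (simp add: e_def)
      then have "{a..<e} \<subseteq> {a..<regs s' ''p''}" by auto
      then show ?thesis using 3(1) that nb(1) unfolding I_def by auto
    qed
    then show ?case
      using 3(1,4) nb(2) unfolding I_def by (auto simp flip: u_def)
  qed
qed

text \<open>
  Here \<open>u\<close> is the first outer node that has a neighbour other than a marked centre.
\<close>

definition augmentable :: "state \<Rightarrow> bool" where
  "augmentable s \<longleftrightarrow> (\<exists>i<regs s ''len''. regs s ''u'' = arrs s ''node'' i \<and>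
     (\<forall>j<i. nb (arrs s ''node'' j) \<subseteq> marked s) \<and>
     regs s ''v'' \<in> nb (regs s ''u'') \<and> \<not> full s (regs s ''v''))"

text \<open>
  Two accounts pay for the search: that of the outer nodes still to be processed, and that of
  the centres still unmarked. Each is bounded by the weight of all nodes.
\<close>

lemma search_loop:
  assumes S: "searching s" and i: "regs s ''i'' = 0" and found: "regs s ''found'' = 0"
  shows "wp search_loop (\<lambda>t s'. t \<le> 200 * weight {..<n} + 20 \<and> searching s' \<and>
    (regs s' ''found'' = 0 \<and> (\<forall>j<regs s' ''len''. nb (arrs s' ''node'' j) \<subseteq> marked s') \<or>
     regs s' ''found'' = 1 \<and> augmentable s')) s"
proof -
  define rest where "rest s' = {..<n} - arrs s' ''node'' ` {..<regs s' ''i''}" for s' :: state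
  define I where "I \<phi> s' \<longleftrightarrow> searching s' \<and>
    (regs s' ''found'' = 0 \<and> \<phi> = 100 * weight (rest s') + credit s' \<and>
       regs s' ''i'' \<le> regs s' ''len'' \<and>
       (\<forall>j<regs s' ''i''. nb (arrs s' ''node'' j) \<subseteq> marked s') \<or>
     regs s' ''found'' = 1 \<and> \<phi> = 0 \<and> augmentable s')"
    for \<phi> and s' :: state
  have w: "weight X \<le> weight {..<n}" if "X \<subseteq> {..<n}" for X
    unfolding weight_def using that by (intro sum_mono2) auto
  show ?thesis
    unfolding search_loop_def
  proof (rule wp_While[where I = I and \<phi> = "100 * weight (rest s) + credit s"], goal_cases)
    case 1
    show ?case unfolding I_def using S i found by simp
  next
    case (2 \<phi> s')
    let ?i = "regs s' ''i''"
    let ?u = "arrs s' ''node'' ?i"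
    define s1 where "s1 = set_reg ''p'' (arrs s' ''start'' ?u) (set_reg ''u'' ?u s')"
    have less: "?i < regs s' ''len''" and found': "regs s' ''found'' = 0" using 2(3) by simp_all
    have I: "searching s'" "\<phi> = 100 * weight (rest s') + credit s'"
      "\<forall>j<?i. nb (arrs s' ''node'' j) \<subseteq> marked s'"
      using 2(1) found' unfolding I_def by auto
    have s1: "regs s1 ''u'' = ?u" "regs s1 ''p'' = arrs s' ''start'' ?u"
      "regs s1 ''len'' = regs s' ''len''" "regs s1 ''found'' = 0" "regs s1 ''i'' = ?i"
      "regs s1 ''n'' = regs s' ''n''" "regs s1 ''k'' = regs s' ''k''"
      "regs s1 ''r'' = regs s' ''r''"
      "arrs s1 = arrs s'"
      by (simp_all add: s1_def found')
    have S1: "searching s1"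
      using I(1) unfolding searching_def adjacency_def s1 .
    have m1: "marked s1 = marked s'" unfolding marked_def s1 ..
    have "wp scan_neighbours (\<lambda>t s''. searching s'' \<and> extends s1 s'' \<and>
      t + credit s'' \<le> 100 * card (nb (regs s1 ''u'')) + credit s1 + 20 \<and>
      (regs s'' ''found'' = 0 \<and> nb (regs s1 ''u'') \<subseteq> marked s'' \<or>
       regs s'' ''found'' = 1 \<and> regs s'' ''v'' \<in> nb (regs s1 ''u'') \<and>
         \<not> full s'' (regs s'' ''v''))) s1"
      by (rule scan_neighbours[OF S1, of ?i]) (simp_all add: s1 less)
    then have "wp scan_neighbours (\<lambda>t s''. \<exists>\<phi>'. I \<phi>' (set_reg ''i'' (Suc (regs s'' ''i'')) s'') \<and>
      t + 50 + \<phi>' \<le> \<phi>) s1"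
    proof (rule wp_conseq, goal_cases)
      case (1 t s'')
      let ?s = "set_reg ''i'' (Suc (regs s'' ''i'')) s''"
      have Q: "searching s''" "extends s1 s''"
        "t + credit s'' \<le> 100 * card (nb ?u) + credit s' + 20"
        "regs s'' ''found'' = 0 \<and> nb ?u \<subseteq> marked s'' \<or>
         regs s'' ''found'' = 1 \<and> regs s'' ''v'' \<in> nb ?u \<and> \<not> full s'' (regs s'' ''v'')"
        using 1(1) unfolding s1 m1 by blast+
      have fr: "regs s'' ''u'' = ?u" "regs s'' ''i'' = ?i"
        using 1(2) by (simp_all add: s1 frame_def scan_neighbours_def visit_neighbour_def
            push_leaves_def)
      have ext: "regs s' ''len'' \<le> regs s'' ''len''"
        "\<And>j. j < regs s' ''len'' \<Longrightarrow> arrs s'' ''node'' j = arrs s' ''node'' j"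
        "marked s' \<subseteq> marked s''"
        using Q(2) unfolding extends_def s1 m1 by auto
      have S2: "searching ?s" using Q(1) unfolding searching_def adjacency_def by simp
      have m2: "marked ?s = marked s''" unfolding marked_def by simp
      have un: "?u < n" using searching_node[OF I(1) less] .
      have "inj_on (arrs s' ''node'') {..<regs s' ''len''}"
        using I(1) unfolding searching_def search_inv_def by blast
      then have "?u \<notin> arrs s' ''node'' ` {..<?i}"
        using less by (auto dest: inj_onD)
      then have "?u \<in> rest s'" unfolding rest_def using un by simp
      moreover have "rest ?s = rest s' - {?u}"
        unfolding rest_def using less ext(2) by (auto simp: fr lessThan_Suc)
      moreover have "finite (rest s')" unfolding rest_def by simp
      ultimately have wt: "weight (rest s') = Suc (card (nb ?u)) + weight (rest ?s)"
        by (simp add: weight_remove)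
      have old: "nb (arrs s'' ''node'' j) \<subseteq> marked s''" if "j < ?i" for j
        using I(3) ext(2,3) that less by auto
      show ?case
      proof (cases "regs s'' ''found'' = 0")
        case True
        then have "I (100 * weight (rest ?s) + credit ?s) ?s"
          unfolding I_def m2 using S2 less ext(1,2) Q(4) old
          by (auto simp: fr less_Suc_eq)
        moreover have "t + 50 + (100 * weight (rest ?s) + credit ?s) \<le> \<phi>"
          using Q(3) I(2) wt unfolding m2 by simp
        ultimately show ?thesis by blast
      next
        case False
        have "augmentable ?s"
          unfolding augmentable_def m2 using less ext(1,2) Q(4) old False
          by (intro exI[of _ ?i]) (simp add: fr full_def)
        then have "I 0 ?s" unfolding I_def using S2 Q(4) False by simp
        moreover have "t + 50 + 0 \<le> \<phi>" using Q(3) I(2) wt by simp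
        ultimately show ?thesis by blast
      qed
    qed
    then show ?case
      apply (simp flip: s1_def)
      apply (erule wp_conseq)
      subgoal for t s''
        by clarsimp (rule exI, rule conjI, assumption, simp)
      done
  next
    case (3 \<phi> t s')
    have "weight (rest s) \<le> weight {..<n}" "weight ({..<n} - marked s) \<le> weight {..<n}"
      by (rule w, simp add: rest_def)+
    then have "t \<le> 200 * weight {..<n} + 20" using 3(4) by simp
    then show ?case using 3(1,3) unfolding I_def by auto
  qed
qed

lemma search:
  assumes "adjacency s" "star_system (arrs s ''par'') (arrs s ''cnt'') {}"
    "regs s ''r'' < n" "arrs s ''par'' (regs s ''r'') = 0" "arrs s ''cnt'' (regs s ''r'') = 0"
    "\<forall>c<n. arrs s ''mark'' c \<le> regs s ''r''"
  shows "wp search (\<lambda>t s'. t \<le> 200 * weight {..<n} + 40 \<and> searching s' \<and>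
    (regs s' ''found'' = 0 \<and> (\<forall>j<regs s' ''len''. nb (arrs s' ''node'' j) \<subseteq> marked s') \<or>
     regs s' ''found'' = 1 \<and> augmentable s')) s"
proof -
  define s1 where "s1 = set_reg ''found'' 0 (set_reg ''i'' 0 (set_reg ''len'' 1
    (set_cell ''node'' 0 (regs s ''r'') s)))"
  have "search_inv (regs s ''r'') (arrs s ''par'') (arrs s ''cnt'') (arrs s ''mark'')
      (arrs s ''pred'') ((arrs s ''node'')(0 := regs s ''r'')) 1"
    using assms(6) by (rule search_inv_init) simp
  moreover have "\<forall>c<n. arrs s ''mark'' c \<le> Suc (regs s ''r'')"
    using assms(6) le_SucI by blast
  ultimately have "searching s1"
    using assms unfolding searching_def adjacency_def s1_def by simp
  then have "wp search_loop (\<lambda>t s'. t \<le> 200 * weight {..<n} + 20 \<and> searching s' \<and>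
    (regs s' ''found'' = 0 \<and> (\<forall>j<regs s' ''len''. nb (arrs s' ''node'' j) \<subseteq> marked s') \<or>
     regs s' ''found'' = 1 \<and> augmentable s')) s1"
    by (rule search_loop) (simp_all add: s1_def)
  then show ?thesis
    unfolding search_def
    apply (simp flip: s1_def One_nat_def)
    apply (erule wp_conseq)
    apply simp
    done
qed

end

section \<open>Augmenting\<close>

context input_graph
begin

definition covered :: "state \<Rightarrow> nat \<Rightarrow> bool" where
  "covered s v \<longleftrightarrow> arrs s ''par'' v \<noteq> 0 \<or> arrs s ''cnt'' v \<noteq> 0"

text \<open>
  Apart from \<open>v\<close> itself, only the centre of a star with a single leaf can change its role.
  Such a centre is not full, so it is not part of the search tree.
\<close>

lemma make_centre:
  assumes st: "star_system (arrs s ''par'') (arrs s ''cnt'') {}"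
    and v: "regs s ''v'' = v" "v < n" "\<not> full s v"
  shows "wp make_centre (\<lambda>t s'. t \<le> 50 \<and>
    star_system (arrs s' ''par'') (arrs s' ''cnt'') {} \<and>
    arrs s' ''par'' v = 0 \<and> arrs s' ''cnt'' v < k \<and>
    (\<forall>w. w \<noteq> v \<longrightarrow> covered s w \<longrightarrow> covered s' w) \<and>
    (\<forall>w. w \<noteq> v \<longrightarrow> arrs s ''cnt'' w = 0 \<longrightarrow> arrs s' ''cnt'' w = 0) \<and>
    (\<forall>w. w \<noteq> v \<longrightarrow> arrs s' ''par'' w = arrs s ''par'' w \<or>
       arrs s ''par'' w = 0 \<and> arrs s ''cnt'' w = 1)) s"
proof (cases "arrs s ''par'' v")
  case 0
  then have "arrs s ''cnt'' v < k"
    using v(2,3) star_systemD(5)[OF st v(2)] unfolding full_def by simp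
  then show ?thesis using 0 st v(1) unfolding make_centre_def by simp
next
  case (Suc c)
  define par where "par = arrs s ''par''"
  define cnt where "cnt = arrs s ''cnt''"
  define par1 where "par1 = par(v := 0)"
  define cnt1 where "cnt1 = cnt(c := cnt c - 1)"
  have par_v: "par v = Suc c" using Suc by (simp add: par_def)
  have st0: "star_system par cnt {}" using st by (simp add: par_def cnt_def)
  have edge: "{v, c} \<in> E" and par_c: "par c = 0" and c: "c < n"
    using star_systemD(1,3,2)[OF st0 v(2) par_v] by blast+
  have vc: "v \<noteq> c" using edgeD(3)[OF edge] .
  have st1: "star_system par1 cnt1 {}"
    unfolding par1_def cnt1_def using st0 v(2) par_v by (rule star_system_detach)
  have cnt_v: "cnt v = 0"
    using no_leaves[OF st0 v(2)] par_v star_systemD(4)[OF st0 v(2)] by simp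
  have cnt_c: "cnt c \<noteq> 0"
  proof -
    have "v \<in> leaves par c" using v(2) par_v by (simp add: leaves_def)
    then show ?thesis using star_systemD(4)[OF st0 c] by auto
  qed
  show ?thesis
  proof (cases "cnt1 c = 0")
    case True
    have cnt1_v: "cnt1 v = 0" using cnt_v vc by (simp add: cnt1_def)
    have "star_system par1 (cnt1(v := Suc (cnt1 v))) {v}"
      using st1 by (rule star_system_promise) (use cnt1_v k_ge_2 in simp)
    moreover have "leaves par1 c = {}" using no_leaves[OF st1 c] True by simp
    ultimately have "star_system (par1(c := Suc v)) (cnt1(v := Suc (cnt1 v))) {x. par1 c = Suc x}"
      using edgeD(4)[OF edge] by (intro star_system_attach) (simp_all add: par1_def)
    moreover have "{x. par1 c = Suc x} = {}" using par_c vc by (simp add: par1_def)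
    ultimately have "star_system (par1(c := Suc v)) (cnt1(v := Suc (cnt1 v))) {}" by simp
    moreover have "cnt c = 1" using True cnt_c by (simp add: cnt1_def)
    ultimately show ?thesis
      using v(1) vc par_v par_c cnt_v k_ge_2 unfolding make_centre_def par1_def cnt1_def covered_def
      by (auto simp: par_def cnt_def)
  next
    case False
    then show ?thesis
      using v(1) vc par_v par_c cnt_v k_ge_2 st1 unfolding make_centre_def par1_def cnt1_def covered_def
      by (auto simp: par_def cnt_def)
  qed
qed

text \<open>
  The potential is the position of \<open>a\<close> in the queue. Only nodes at later positions have changed
  their stars, so the rest of the path is still as the search has found it.
\<close>

lemma shift_leaves:
  assumes inv: "search_inv r par cnt mark pred node len" and r: "par r = 0" "r < n"
    and i: "i < len" and a: "regs s ''a'' = node i"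
    and st: "star_system (arrs s ''par'') (arrs s ''cnt'') {regs s ''t''}"
    and t: "arrs s ''par'' (regs s ''t'') = 0" "regs s ''t'' \<noteq> r" "{node i, regs s ''t''} \<in> E"
    and root: "leaves (arrs s ''par'') r = {}"
    and same: "\<forall>j\<le>i. arrs s ''par'' (node j) = par (node j)"
    and mark: "\<forall>c<n. mark c = Suc r \<longrightarrow> arrs s ''par'' c = 0 \<and> c \<noteq> r"
    and pred: "arrs s ''pred'' = pred"
  shows "wp shift_leaves (\<lambda>t s'. t \<le> 30 * i + 10 \<and> regs s' ''a'' = r \<and>
    star_system (arrs s' ''par'') (arrs s' ''cnt'') {regs s' ''t''} \<and>
    arrs s' ''par'' r = 0 \<and> arrs s' ''par'' (regs s' ''t'') = 0 \<and> {r, regs s' ''t''} \<in> E \<and>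
    leaves (arrs s' ''par'') r = {} \<and>
    (\<forall>w. arrs s ''par'' w \<noteq> 0 \<longrightarrow> arrs s' ''par'' w \<noteq> 0)) s"
proof -
  define J where "J j s' \<longleftrightarrow> j \<le> i \<and> regs s' ''a'' = node j \<and>
    star_system (arrs s' ''par'') (arrs s' ''cnt'') {regs s' ''t''} \<and>
    arrs s' ''par'' (regs s' ''t'') = 0 \<and> regs s' ''t'' \<noteq> r \<and> {node j, regs s' ''t''} \<in> E \<and>
    leaves (arrs s' ''par'') r = {} \<and>
    (\<forall>j'\<le>j. arrs s' ''par'' (node j') = par (node j')) \<and>
    (\<forall>c<n. mark c = Suc r \<longrightarrow> arrs s' ''par'' c = 0) \<and>
    (\<forall>w. arrs s ''par'' w \<noteq> 0 \<longrightarrow> arrs s' ''par'' w \<noteq> 0)" for j and s' :: state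
  define I where "I \<phi> s' \<longleftrightarrow> (\<exists>j. \<phi> = 30 * j \<and> J j s')" for \<phi> and s' :: state
  have inj: "inj_on node {..<len}" and node0: "node 0 = r"
    using inv unfolding search_inv_def by blast+
  show ?thesis
    unfolding shift_leaves_def
  proof (rule wp_While[where I = I and \<phi> = "30 * i"], goal_cases)
    case 1
    have "J i s" unfolding J_def using assms by auto
    then show ?case unfolding I_def by blast
  next
    case (2 \<phi> s')
    obtain j where \<phi>: "\<phi> = 30 * j" and "J j s'" using 2(1) unfolding I_def by blast
    define p' where "p' = arrs s' ''par''"
    define t' where "t' = regs s' ''t''"
    have J: "j \<le> i" "regs s' ''a'' = node j" "star_system p' (arrs s' ''cnt'') {t'}"
      "p' t' = 0" "t' \<noteq> r" "{node j, t'} \<in> E" "leaves p' r = {}"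
      "\<And>j'. j' \<le> j \<Longrightarrow> p' (node j') = par (node j')"
      "\<And>c. c < n \<Longrightarrow> mark c = Suc r \<Longrightarrow> p' c = 0"
      "\<And>w. arrs s ''par'' w \<noteq> 0 \<Longrightarrow> p' w \<noteq> 0"
      using \<open>J j s'\<close> unfolding J_def p'_def t'_def by blast+
    have "p' (node j) \<noteq> 0" using 2(3) J(2) by (simp add: p'_def)
    then obtain c where c: "p' (node j) = Suc c" by (cases "p' (node j)") auto
    then have "par (node j) = Suc c" using J(8)[of j] by simp
    moreover have "j < len" using J(1) i by simp
    ultimately obtain j' where path: "c < n" "mark c = Suc r" "j' < j" "pred c = node j'"
        "{node j', c} \<in> E"
      using search_inv_path[OF inv _ _ r(1)] by blast
    have p'c: "p' c = 0" using J(9) path by blast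
    have nj: "node j < n" "node j \<noteq> t'" using edgeD[OF J(6)] by blast+
    have "leaves p' (node j) = {}" using no_leaves[OF J(3) nj(1)] c by simp
    then have "star_system (p'(node j := Suc t')) (arrs s' ''cnt'') {x. p' (node j) = Suc x}"
      by (rule star_system_attach[OF J(3,6,4)])
    moreover have "{x. p' (node j) = Suc x} = {c}" using c by auto
    ultimately have st': "star_system (p'(node j := Suc t')) (arrs s' ''cnt'') {c}" by simp
    have pred': "arrs s' ''pred'' = pred" using 2(2) pred by (simp add: frame_def)
    have other: "node x \<noteq> node j" if "x \<le> j'" for x
      using inj_onD[OF inj, of x j] that path(3) \<open>j < len\<close> by auto
    have cj: "c \<noteq> node j" using p'c c by auto
    define s2 where "s2 = set_reg ''a'' (node j') (set_reg ''t'' c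
      (set_cell ''par'' (node j) (Suc t') (set_reg ''c'' c s')))"
    have s2: "regs s2 ''a'' = node j'" "regs s2 ''t'' = c" "arrs s2 ''cnt'' = arrs s' ''cnt''"
      "arrs s2 ''par'' = p'(node j := Suc t')"
      by (simp_all add: s2_def p'_def)
    have "leaves (p'(node j := Suc t')) r = {}"
      using J(5,7) by (auto simp: leaves_def)
    moreover have "(p'(node j := Suc t')) x = 0" if "x < n" "mark x = Suc r" for x
      using J(9)[OF that] c by auto
    moreover have "c \<noteq> r" using mark path by blast
    moreover have "(p'(node j := Suc t')) (node x) = par (node x)" if "x \<le> j'" for x
      using J(8)[of x] other[OF that] that path(3) by simp
    ultimately have "J j' s2"
      unfolding J_def s2 using st' J(1,10) path(3,5) p'c cj by auto
    then have "I (30 * j') s2" unfolding I_def by blast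
    moreover have "30 * j' + 30 \<le> \<phi>" using \<phi> path(3) by simp
    ultimately show ?case
      using J(2) c pred' path(4)
      by (auto simp: s2_def p'_def t'_def intro!: exI[of _ "30 * j'"])
  next
    case (3 \<phi> t s')
    obtain j where "J j s'" using 3(1) unfolding I_def by blast
    then have J: "j \<le> i" "regs s' ''a'' = node j" "arrs s' ''par'' (node j) = par (node j)"
      unfolding J_def by blast+
    have "arrs s' ''par'' (node j) = 0" using 3(3) J(2) by simp
    then have "j = 0"
      using J(1,3) i inv unfolding search_inv_def
      by (metis Zero_not_Suc le_less_trans not_gr_zero)
    then have "node j = r" using node0 by simp
    then show ?case using \<open>J j s'\<close> J(2) \<open>arrs s' ''par'' (node j) = 0\<close> 3(4) \<open>j = 0\<close>
      unfolding J_def by simp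
  qed
qed

text \<open>
  The nodes covered so far stay covered: each node of the path finds a new centre, all centres on
  it keep their number of leaves, and \<open>v\<close> receives at least one leaf.
\<close>

lemma augment:
  assumes S: "searching s" and aug: "augmentable s"
  shows "wp augment (\<lambda>t s'. t \<le> 30 * n + 100 \<and>
    star_system (arrs s' ''par'') (arrs s' ''cnt'') {} \<and>
    (\<forall>w<n. covered s w \<or> w = regs s ''r'' \<longrightarrow> covered s' w)) s"
proof -
  define r where "r = regs s ''r''"
  define v where "v = regs s ''v''"
  define par cnt where "par = arrs s ''par''" and "cnt = arrs s ''cnt''"
  define mark pred where "mark = arrs s ''mark''" and "pred = arrs s ''pred''"
  define node len where "node = arrs s ''node''" and "len = regs s ''len''"
  have st: "star_system par cnt {}" and r: "r < n" "par r = 0" "cnt r = 0"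
    and inv: "search_inv r par cnt mark pred node len"
    using S unfolding searching_def r_def par_def cnt_def mark_def pred_def node_def len_def
    by blast+
  obtain i where i: "i < len" "regs s ''u'' = node i"
    and processed: "\<forall>j<i. nb (node j) \<subseteq> marked s"
    and edge: "{node i, v} \<in> E" and v: "\<not> full s v"
    using aug unfolding augmentable_def nb_iff v_def node_def len_def by metis
  have node0: "node 0 = r" and inj: "inj_on node {..<len}"
    using inv unfolding search_inv_def by blast+
  have vn: "v < n" "v \<noteq> node i" using edgeD[OF edge] by auto
  \<comment> \<open>The path must not run through \<open>v\<close>. If \<open>v\<close> were an earlier outer node, its neighbours,
    among them \<open>u\<close>, would all be full centres.\<close>
  have not_v: "node j \<noteq> v" if "j \<le> i" for j
  proof (cases "j = i")
    case True
    then show ?thesis using vn by auto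
  next
    case False
    show ?thesis
    proof
      assume "node j = v"
      then have "node i \<in> nb (node j)" using edgeD(4)[OF edge] by (simp add: nb_iff)
      moreover have "j < i" using that False by simp
      ultimately have "node i \<in> marked s" using processed by blast
      then have "par (node i) = 0 \<and> cnt (node i) = k"
        using search_inv_full[OF inv, of "node i"] unfolding marked_def mark_def r_def by blast
      then show False using search_inv_not_full[OF inv i(1) r(3,2)] by blast
    qed
  qed
  have vr: "v \<noteq> r" using not_v[of 0] node0 by auto
  have "node i < n" using edgeD[OF edge] by blast
  have "i \<le> n"
  proof -
    have "node ` {..<len} \<subseteq> {..<n}"
      using searching_node[OF S] unfolding node_def len_def by auto
    then have "card (node ` {..<len}) \<le> n" using card_mono[of "{..<n}"] by fastforce
    then show ?thesis using i(1) inj by (simp add: card_image)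
  qed
  have "wp make_centre (\<lambda>t s'. t \<le> 50 \<and>
    star_system (arrs s' ''par'') (arrs s' ''cnt'') {} \<and>
    arrs s' ''par'' v = 0 \<and> arrs s' ''cnt'' v < k \<and>
    (\<forall>w. w \<noteq> v \<longrightarrow> covered s w \<longrightarrow> covered s' w) \<and>
    (\<forall>w. w \<noteq> v \<longrightarrow> arrs s ''cnt'' w = 0 \<longrightarrow> arrs s' ''cnt'' w = 0) \<and>
    (\<forall>w. w \<noteq> v \<longrightarrow> arrs s' ''par'' w = arrs s ''par'' w \<or>
       arrs s ''par'' w = 0 \<and> arrs s ''cnt'' w = 1)) s"
    using st vn v by (intro make_centre) (simp_all add: par_def cnt_def v_def)
  then show ?thesis
    unfolding augment_def block.simps wp_Seq
  proof (rule wp_conseq, goal_cases)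
    case (1 t1 s1)
    define par1 cnt1 where "par1 = arrs s1 ''par''" and "cnt1 = arrs s1 ''cnt''"
    have mc: "t1 \<le> 50" "star_system par1 cnt1 {}" "par1 v = 0" "cnt1 v < k"
      "\<And>w. w \<noteq> v \<Longrightarrow> covered s w \<Longrightarrow> covered s1 w"
      "\<And>w. w \<noteq> v \<Longrightarrow> cnt w = 0 \<Longrightarrow> cnt1 w = 0"
      "\<And>w. w \<noteq> v \<Longrightarrow> par1 w = par w \<or> par w = 0 \<and> cnt w = 1"
      using 1(1) unfolding par1_def cnt1_def par_def cnt_def by blast+
    have fr: "regs s1 ''u'' = node i" "regs s1 ''v'' = v" "arrs s1 ''pred'' = pred"
      using 1(2) i(2) by (simp_all add: frame_def make_centre_def v_def pred_def)
    define s2 where "s2 = set_reg ''a'' (node i) (set_reg ''t'' v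
      (set_cell ''cnt'' v (Suc (cnt1 v)) s1))"
    have s2: "regs s2 ''a'' = node i" "regs s2 ''t'' = v" "arrs s2 ''par'' = par1"
      "arrs s2 ''cnt'' = cnt1(v := Suc (cnt1 v))" "arrs s2 ''pred'' = pred"
      by (simp_all add: s2_def par1_def cnt1_def fr)
    have st2: "star_system par1 (cnt1(v := Suc (cnt1 v))) {v}"
      using mc(2,4) by (rule star_system_promise)
    have "leaves par1 r = {}"
      using no_leaves[OF mc(2) r(1)] mc(6)[of r] vr r(3) by simp
    moreover have "par1 (node j) = par (node j)" if "j \<le> i" for j
    proof -
      have "\<not> (par (node j) = 0 \<and> cnt (node j) = 1)"
      proof (cases "j = 0")
        case True
        then show ?thesis using node0 r(3) by simp
      next
        case False
        moreover have "j < len" using that i(1) by simp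
        ultimately obtain c where "par (node j) = Suc c"
          using inv unfolding search_inv_def by blast
        then show ?thesis by simp
      qed
      then show ?thesis using mc(7) not_v[OF that] by blast
    qed
    moreover have "par1 c = 0 \<and> c \<noteq> r" if c: "c < n" "mark c = Suc r" for c
    proof -
      have full: "par c = 0" "cnt c = k" using search_inv_full[OF inv c] .
      then have "c \<noteq> v" using v unfolding full_def par_def cnt_def by blast
      moreover have "cnt c \<noteq> 1" "cnt c \<noteq> 0" using full k_ge_2 by simp_all
      ultimately show ?thesis using mc(7)[of c] full r(3) by auto
    qed
    ultimately have "wp shift_leaves (\<lambda>t s'. t \<le> 30 * i + 10 \<and> regs s' ''a'' = r \<and>
        star_system (arrs s' ''par'') (arrs s' ''cnt'') {regs s' ''t''} \<and>
        arrs s' ''par'' r = 0 \<and> arrs s' ''par'' (regs s' ''t'') = 0 \<and> {r, regs s' ''t''} \<in> E \<and>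
        leaves (arrs s' ''par'') r = {} \<and>
        (\<forall>w. arrs s2 ''par'' w \<noteq> 0 \<longrightarrow> arrs s' ''par'' w \<noteq> 0)) s2"
      using st2 mc(3) vr edge i(1) by (intro shift_leaves[OF inv r(2,1)]) (simp_all add: s2)
    then have "wp shift_leaves (\<lambda>t s'. t \<le> 30 * n + 10 \<and>
        star_system ((arrs s' ''par'')(regs s' ''a'' := Suc (regs s' ''t''))) (arrs s' ''cnt'') {} \<and>
        (\<forall>w<n. covered s w \<or> w = regs s ''r'' \<longrightarrow>
          ((arrs s' ''par'')(regs s' ''a'' := Suc (regs s' ''t''))) w \<noteq> 0 \<or>
          arrs s' ''cnt'' w \<noteq> 0)) s2"
    proof (rule wp_conseq, goal_cases)
      case (1 t s')
      then have Q: "t \<le> 30 * i + 10" "regs s' ''a'' = r"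
        "star_system (arrs s' ''par'') (arrs s' ''cnt'') {regs s' ''t''}"
        "arrs s' ''par'' r = 0" "arrs s' ''par'' (regs s' ''t'') = 0" "{r, regs s' ''t''} \<in> E"
        "leaves (arrs s' ''par'') r = {}"
        "\<And>w. par1 w \<noteq> 0 \<Longrightarrow> arrs s' ''par'' w \<noteq> 0"
        unfolding s2 by blast+
      have cnt': "arrs s' ''cnt'' = cnt1(v := Suc (cnt1 v))"
        using 1(2) s2 by (simp add: frame_def shift_leaves_def)
      have "star_system ((arrs s' ''par'')(r := Suc (regs s' ''t''))) (arrs s' ''cnt'') {}"
        using star_system_attach[OF Q(3,6,5,7)] Q(4) by simp
      moreover have "arrs s' ''par'' w \<noteq> 0 \<or> arrs s' ''cnt'' w \<noteq> 0" if "covered s w" for w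
      proof (cases "w = v")
        case True
        then show ?thesis by (simp add: cnt')
      next
        case False
        then have "covered s1 w" using mc(5) that by blast
        then show ?thesis
          using Q(8)[of w] False unfolding covered_def cnt' by (auto simp: par1_def cnt1_def)
      qed
      ultimately show ?case using Q(1,2) \<open>i \<le> n\<close> by (auto simp: r_def)
    qed
    then show ?case
      using mc(1)
      apply (simp add: fr flip: cnt1_def s2_def)
      apply (erule wp_conseq)
      apply (simp add: covered_def)
      done
  qed
qed

end

section \<open>Covering all nodes\<close>

context input_graph
begin

definition violated :: "state \<Rightarrow> bool" where
  "violated s \<longleftrightarrow> (let S = arrs s ''node'' ` {..<regs s ''len''} in
     stable_set {..<n} E S \<and> card S > k * card (nbhd {..<n} E S))"

text \<open>
  The summand \<open>30 * n\<close> pays for an augmentation; the outer loop stops as soon as a search fails.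
\<close>

lemma cover_all:
  assumes adj: "adjacency s" and r: "regs s ''r'' = 0" and cover: "regs s ''cover'' = 1"
    and zero: "arrs s ''par'' = (\<lambda>_. 0)" "arrs s ''cnt'' = (\<lambda>_. 0)" "arrs s ''mark'' = (\<lambda>_. 0)"
  shows "wp cover_all (\<lambda>t s'. t \<le> n * (200 * weight {..<n} + 30 * n + 300) + 20 \<and>
    (regs s' ''cover'' = 1 \<and> adjacency s' \<and>
       star_system (arrs s' ''par'') (arrs s' ''cnt'') {} \<and> (\<forall>v<n. covered s' v) \<or>
     regs s' ''cover'' = 0 \<and> violated s')) s"
proof -
  define K where "K = 200 * weight {..<n} + 30 * n + 300"
  define I where "I \<phi> s' \<longleftrightarrow>
    regs s' ''cover'' = 1 \<and> \<phi> = (n - regs s' ''r'') * K \<and> regs s' ''r'' \<le> n \<and> adjacency s' \<and>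
      star_system (arrs s' ''par'') (arrs s' ''cnt'') {} \<and>
      (\<forall>c<n. arrs s' ''mark'' c \<le> regs s' ''r'') \<and> (\<forall>v<regs s' ''r''. covered s' v) \<or>
    regs s' ''cover'' = 0 \<and> \<phi> = 0 \<and> violated s'"
    for \<phi> and s' :: state
  show ?thesis
    unfolding cover_all_def
  proof (rule wp_While[where I = I and \<phi> = "n * K"], goal_cases)
    case 1
    have "star_system (arrs s ''par'') (arrs s ''cnt'') {}"
      unfolding star_system_def zero by (simp add: leaves_def)
    then show ?case unfolding I_def using adj r cover zero by simp
  next
    case (2 \<phi> s')
    let ?r = "regs s' ''r''"
    have cover': "regs s' ''cover'' = 1" using 2(3) by simp
    then have I: "\<phi> = (n - ?r) * K" "adjacency s'"
      "star_system (arrs s' ''par'') (arrs s' ''cnt'') {}"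
      "\<forall>c<n. arrs s' ''mark'' c \<le> ?r" "\<forall>v<?r. covered s' v"
      using 2(1) unfolding I_def by auto
    have rn: "?r < n" using 2(3) I(2) by (simp add: adjacency_def)
    have \<phi>: "\<phi> = K + (n - Suc ?r) * K"
    proof -
      have "n - ?r = Suc (n - Suc ?r)" using rn by simp
      then show ?thesis unfolding I(1) by simp
    qed
    have next_inv: "I ((n - Suc ?r) * K) (set_reg ''r'' (Suc ?r) s'')"
      if "regs s'' ''cover'' = 1" "adjacency s''"
        "star_system (arrs s'' ''par'') (arrs s'' ''cnt'') {}"
        "\<forall>c<n. arrs s'' ''mark'' c \<le> Suc ?r" "\<forall>v<Suc ?r. covered s'' v" for s''
      using that rn unfolding I_def adjacency_def covered_def by simp
    show ?case
    proof (cases "covered s' ?r")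
      case True
      have "\<forall>v<Suc ?r. covered s' v" using I(5) True by (simp add: less_Suc_eq)
      then have "I ((n - Suc ?r) * K) (set_reg ''r'' (Suc ?r) s')"
        using I cover' le_SucI by (intro next_inv) blast+
      then show ?thesis
        using True \<phi> unfolding covered_def K_def
        by (auto intro!: exI[of _ "(n - Suc ?r) * K"] simp: K_def)
    next
      case False
      let ?rest = "\<lambda>t s''. \<exists>\<phi>'. I \<phi>' (set_reg ''r'' (Suc (regs s'' ''r'')) s'') \<and> t + 50 + \<phi>' \<le> \<phi>"
      have "wp search (\<lambda>t s''. t \<le> 200 * weight {..<n} + 40 \<and> searching s'' \<and>
        (regs s'' ''found'' = 0 \<and> (\<forall>j<regs s'' ''len''. nb (arrs s'' ''node'' j) \<subseteq> marked s'') \<or>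
         regs s'' ''found'' = 1 \<and> augmentable s'')) s'"
        using I rn False by (intro search) (auto simp: covered_def)
      then have "wp search (\<lambda>t1 s1. wp (Branch (Equal (Reg ''found'') (Const 1)) augment
          (Assign ''cover'' (Const 0))) (\<lambda>t2. ?rest (t1 + t2)) s1) s'"
      proof (rule wp_conseq, goal_cases)
        case (1 t1 s1)
        have fr: "regs s1 ''r'' = ?r" "regs s1 ''cover'' = 1" "arrs s1 ''par'' = arrs s' ''par''"
          "arrs s1 ''cnt'' = arrs s' ''cnt''"
          using 1(2) cover' by (simp_all add: frame_def search_def search_loop_def
              scan_neighbours_def visit_neighbour_def push_leaves_def)
        have t1: "t1 \<le> 200 * weight {..<n} + 40" and S: "searching s1" using 1(1) by blast+
        have cov: "covered s1 v" if "v < ?r" for v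
          using I(5) that unfolding covered_def fr by blast
        from 1(1) consider "regs s1 ''found'' = 0"
            "\<forall>j<regs s1 ''len''. nb (arrs s1 ''node'' j) \<subseteq> marked s1"
          | "regs s1 ''found'' = 1" "augmentable s1"
          by (elim conjE disjE)
        then show ?case
        proof cases
          case 1
          let ?s = "set_reg ''r'' (Suc ?r) (set_reg ''cover'' 0 s1)"
          have "\<forall>j<regs s1 ''len''. \<forall>y\<in>nb (arrs s1 ''node'' j). arrs s1 ''mark'' y = Suc ?r"
            using 1(2) unfolding marked_def fr by blast
          then have "violated ?s"
            using S search_inv_violator[of ?r "arrs s1 ''par''" "arrs s1 ''cnt''" "arrs s1 ''mark''"
                "arrs s1 ''pred''" "arrs s1 ''node''" "regs s1 ''len''"]
            unfolding searching_def violated_def fr by (simp add: Let_def)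
          then have "I 0 ?s" unfolding I_def by simp
          then show ?thesis
            using 1 t1 \<phi> by (auto simp: fr K_def intro!: exI[of _ 0])
        next
          case 2
          from augment[OF S 2(2)]
          have "wp augment (\<lambda>t2 s2. ?rest (t1 + t2 + 10) s2) s1"
          proof (rule wp_conseq, goal_cases)
            case (1 t2 s2)
            have fr2: "regs s2 ''r'' = ?r" "regs s2 ''cover'' = 1" "arrs s2 ''mark'' = arrs s1 ''mark''"
              "arrs s2 ''adj'' = arrs s1 ''adj''" "arrs s2 ''start'' = arrs s1 ''start''"
              "regs s2 ''n'' = regs s1 ''n''" "regs s2 ''k'' = regs s1 ''k''"
              using 1(2) by (simp_all add: fr frame_def augment_def make_centre_def shift_leaves_def)
            have "\<forall>v<Suc ?r. covered s2 v"
              using 1(1) cov rn unfolding fr less_Suc_eq by auto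
            moreover have "adjacency s2"
              using S unfolding searching_def adjacency_def fr2 by blast
            moreover have "\<forall>c<n. arrs s2 ''mark'' c \<le> Suc ?r"
              using S unfolding searching_def fr2 fr by blast
            ultimately have "I ((n - Suc ?r) * K) (set_reg ''r'' (Suc ?r) s2)"
              using 1(1) fr2 by (intro next_inv) auto
            then show ?case
              using 1(1) t1 \<phi> unfolding fr2(1)
              by (intro exI[of _ "(n - Suc ?r) * K"]) (simp add: K_def)
          qed
          then show ?thesis
            using 2(1) by (simp, elim wp_conseq) (auto simp: algebra_simps)
        qed
      qed
      then show ?thesis
        using False unfolding covered_def
        apply simp
        apply (erule wp_conseq)
        apply (simp split: if_splits)
         apply (erule wp_conseq, clarsimp, rule exI, rule conjI, assumption, simp)
        apply (clarsimp, rule exI, rule conjI, assumption, simp)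
        done
    qed
  next
    case (3 \<phi> t s')
    then show ?case unfolding I_def K_def by (auto simp: adjacency_def)
  qed
qed

end

section \<open>Listing the matchings\<close>

context input_graph
begin

text \<open>
  The counter of a centre is a lower bound for the indices handed out so far at that centre, so
  the next index is new there.
\<close>

definition listed ::
  "(nat \<Rightarrow> nat) \<Rightarrow> (nat \<Rightarrow> nat) \<Rightarrow> nat \<Rightarrow> (nat \<Rightarrow> nat) \<Rightarrow> nat \<Rightarrow>
   (nat \<Rightarrow> nat) \<Rightarrow> (nat \<Rightarrow> nat) \<Rightarrow> (nat \<Rightarrow> nat) \<Rightarrow> bool" where
  "listed par cnt0 w cnt len index end1 end2 \<longleftrightarrow>
     (\<forall>c<n. cnt c + card {x \<in> leaves par c. x < w} = cnt0 c) \<and>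
     (\<forall>j<len. end1 j < n \<and> par (end1 j) = Suc (end2 j) \<and>
        cnt (end2 j) \<le> index j \<and> index j < cnt0 (end2 j)) \<and>
     (\<forall>x<w. par x \<noteq> 0 \<longrightarrow> (\<exists>j<len. end1 j = x)) \<and>
     (\<forall>j<len. \<forall>j'<len. end2 j = end2 j' \<and> index j = index j' \<longrightarrow> end1 j = end1 j')"

lemma listed_init:
  "listed par cnt 0 cnt 0 index end1 end2"
  by (simp add: listed_def)

lemma listed_skip:
  assumes "listed par cnt0 w cnt len index end1 end2" "par w = 0"
  shows "listed par cnt0 (Suc w) cnt len index end1 end2"
proof -
  have eq: "{x \<in> leaves par c. x < Suc w} = {x \<in> leaves par c. x < w}" for c
    using assms(2) by (auto simp: leaves_def less_Suc_eq)
  have "x < w" if "x < Suc w" "par x \<noteq> 0" for x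
    using that assms(2) by (auto simp: less_Suc_eq)
  then have "\<forall>x<Suc w. par x \<noteq> 0 \<longrightarrow> (\<exists>j<len. end1 j = x)"
    using assms(1) unfolding listed_def by blast
  then show ?thesis using assms(1) unfolding listed_def eq by blast
qed

lemma listed_push:
  assumes l: "listed par cnt0 w cnt len index end1 end2" and st: "star_system par cnt0 {}"
    and w: "w < n" "par w = Suc c"
  shows "listed par cnt0 (Suc w) (cnt(c := cnt c - 1)) (Suc len)
    (index(len := cnt c - 1)) (end1(len := w)) (end2(len := c))"
proof -
  have c: "c < n" using star_systemD(2)[OF st w] .
  have more: "{x \<in> leaves par d. x < Suc w} =
      (if d = c then insert w {x \<in> leaves par d. x < w} else {x \<in> leaves par d. x < w})" for d
    using w by (auto simp: leaves_def less_Suc_eq)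
  have count: "cnt d + card {x \<in> leaves par d. x < w} = cnt0 d" if "d < n" for d
    using l that unfolding listed_def by blast
  have "card {x \<in> leaves par c. x < Suc w} \<le> card (leaves par c)"
    by (rule card_mono) auto
  then have "Suc (card {x \<in> leaves par c. x < w}) \<le> cnt0 c"
    using star_systemD(4)[OF st c] unfolding more by simp
  then have pos: "0 < cnt c" using count[OF c] by simp
  have le: "cnt c \<le> cnt0 c" using count[OF c] by simp
  have "(cnt(c := cnt c - 1)) d + card {x \<in> leaves par d. x < Suc w} = cnt0 d" if "d < n" for d
    using count[OF that] pos unfolding more by (cases "d = c") auto
  moreover have old: "end1 j < n" "par (end1 j) = Suc (end2 j)" "cnt (end2 j) \<le> index j"
      "index j < cnt0 (end2 j)" if "j < len" for j
    using l that unfolding listed_def by blast+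
  have "(end1(len := w)) j < n \<and> par ((end1(len := w)) j) = Suc ((end2(len := c)) j) \<and>
      (cnt(c := cnt c - 1)) ((end2(len := c)) j) \<le> (index(len := cnt c - 1)) j \<and>
      (index(len := cnt c - 1)) j < cnt0 ((end2(len := c)) j)" if "j < Suc len" for j
  proof (cases "j = len")
    case True
    then show ?thesis using w pos le by simp
  next
    case False
    then have "j < len" using that by simp
    then show ?thesis using old[of j] by auto
  qed
  moreover have "\<exists>j<Suc len. (end1(len := w)) j = x" if x: "x < Suc w" "par x \<noteq> 0" for x
  proof (cases "x = w")
    case True
    then show ?thesis by auto
  next
    case False
    then have "x < w" using x(1) by simp
    then obtain j where "j < len" "end1 j = x" using l x(2) unfolding listed_def by blast
    then show ?thesis by (intro exI[of _ j]) simp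
  qed
  moreover have "(end1(len := w)) j = (end1(len := w)) j'"
    if jj: "j < Suc len" "j' < Suc len" "(end2(len := c)) j = (end2(len := c)) j'"
      "(index(len := cnt c - 1)) j = (index(len := cnt c - 1)) j'" for j j'
  proof -
    have fresh: "\<not> (end2 x = c \<and> index x = cnt c - 1)" if "x < len" for x
      using old(3)[OF that] pos by auto
    consider "j < len" "j' < len" | "j = len" "j' = len" | "j < len" "j' = len" | "j = len" "j' < len"
      using jj(1,2) less_SucE by metis
    then show ?thesis
    proof cases
      case 1
      then have "end2 j = end2 j' \<and> index j = index j'" using jj(3,4) by simp
      then have "end1 j = end1 j'" using l 1 unfolding listed_def by blast
      then show ?thesis using 1 by simp
    next
      case 2
      then show ?thesis by simp
    next
      case 3
      then show ?thesis using fresh[of j] jj(3,4) by simp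
    next
      case 4
      then show ?thesis using fresh[of j'] jj(3,4) by simp
    qed
  qed
  ultimately show ?thesis unfolding listed_def by blast
qed

text \<open>
  Two listed edges that share a node belong to the same star, and equal indices within a
  star mean equal edges.
\<close>

lemma listed_cover:
  assumes l: "listed par cnt0 n cnt len index end1 end2" and st: "star_system par cnt0 {}"
    and cov: "\<forall>v<n. par v \<noteq> 0 \<or> cnt0 v \<noteq> 0"
  shows "{index j | j. j < len} \<subseteq> {..<k}"
    and "matching_k_cover {..<n} E k (\<lambda>i. {{end1 j, end2 j} | j. j < len \<and> index j = i})"
proof -
  have entry: "end1 j < n" "par (end1 j) = Suc (end2 j)" "index j < cnt0 (end2 j)" if "j < len" for j
    using l that unfolding listed_def by blast+
  have edge: "{end1 j, end2 j} \<in> E" "par (end2 j) = 0" "end2 j < n" if "j < len" for j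
    using star_systemD(1,3,2)[OF st entry(1,2)[OF that]] by blast+
  have index: "index j < k" if "j < len" for j
    using entry(3)[OF that] star_systemD(5)[OF st edge(3)[OF that]] by simp
  then show "{index j | j. j < len} \<subseteq> {..<k}" by auto
  have same: "end1 j = end1 j' \<and> end2 j = end2 j'"
    if j: "j < len" "j' < len" "index j = index j'"
      and x: "x \<in> {end1 j, end2 j}" "x \<in> {end1 j', end2 j'}" for j j' x
  proof -
    have "end1 j = end1 j' \<or> end2 j = end2 j'"
      using x entry(2)[OF j(1)] entry(2)[OF j(2)] edge(2)[OF j(1)] edge(2)[OF j(2)] by auto
    then show ?thesis
    proof
      assume "end1 j = end1 j'"
      then show ?thesis using entry(2)[OF j(1)] entry(2)[OF j(2)] by simp
    next
      assume "end2 j = end2 j'"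
      then show ?thesis using l j unfolding listed_def by blast
    qed
  qed
  have "matching E {{end1 j, end2 j} | j. j < len \<and> index j = i}" for i
    unfolding matching_def
  proof (intro conjI pairwiseI)
    show "{{end1 j, end2 j} | j. j < len \<and> index j = i} \<subseteq> E" using edge(1) by blast
  next
    fix e f
    assume e: "e \<in> {{end1 j, end2 j} | j. j < len \<and> index j = i}"
      and f: "f \<in> {{end1 j, end2 j} | j. j < len \<and> index j = i}" and "e \<noteq> f"
    obtain j where j: "j < len" "index j = i" "e = {end1 j, end2 j}" using e by blast
    obtain j' where j': "j' < len" "index j' = i" "f = {end1 j', end2 j'}" using f by blast
    show "disjnt e f"
      unfolding disjnt_iff
    proof (intro allI notI, elim conjE)
      fix x assume "x \<in> e" "x \<in> f"
      then have "end1 j = end1 j' \<and> end2 j = end2 j'"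
        using same[of j j' x] j j' by simp
      then show False using j(3) j'(3) \<open>e \<noteq> f\<close> by simp
    qed
  qed
  moreover have "\<exists>e\<in>(\<Union>i<k. {{end1 j, end2 j} | j. j < len \<and> index j = i}). v \<in> e" if "v < n" for v
  proof -
    have "\<exists>j<len. v \<in> {end1 j, end2 j}"
    proof (cases "par v = 0")
      case False
      then show ?thesis using l that unfolding listed_def by blast
    next
      case True
      then have "leaves par v \<noteq> {}" using cov that star_systemD(4)[OF st that] by auto
      then obtain x where x: "x < n" "par x = Suc v" by (auto simp: leaves_def)
      then obtain j where j: "j < len" "end1 j = x" using l unfolding listed_def by (metis Zero_not_Suc)
      then have "end2 j = v" using entry(2)[OF j(1)] x(2) by simp
      then show ?thesis using j(1) by blast
    qed
    then show ?thesis using index by blast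
  qed
  ultimately show "matching_k_cover {..<n} E k
      (\<lambda>i. {{end1 j, end2 j} | j. j < len \<and> index j = i})"
    unfolding matching_k_cover_def by blast
qed

lemma list_edges:
  assumes "adjacency s" and st: "star_system (arrs s ''par'') (arrs s ''cnt'') {}"
    and cov: "\<forall>v<n. covered s v" and init: "regs s ''len'' = 0" "regs s ''w'' = 0"
  shows "wp list_edges (\<lambda>t s'. t \<le> 60 * n + 10 \<and> out_indices s' \<subseteq> {..<k} \<and>
    matching_k_cover {..<n} E k (out_matchings s')) s"
proof -
  define par cnt0 where "par = arrs s ''par''" and "cnt0 = arrs s ''cnt''"
  define I where "I \<phi> s' \<longleftrightarrow> \<phi> = 60 * (n - regs s' ''w'') \<and> regs s' ''w'' \<le> n \<and>
    listed par cnt0 (regs s' ''w'') (arrs s' ''cnt'') (regs s' ''len'') (arrs s' ''index'')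
      (arrs s' ''end1'') (arrs s' ''end2'')" for \<phi> and s' :: state
  have n: "regs s ''n'' = n" using assms(1) unfolding adjacency_def by blast
  have st0: "star_system par cnt0 {}" using st by (simp add: par_def cnt0_def)
  show ?thesis
    unfolding list_edges_def
  proof (rule wp_While[where I = I and \<phi> = "60 * n"], goal_cases)
    case 1
    show ?case unfolding I_def using init by (simp add: listed_init cnt0_def)
  next
    case (2 \<phi> s')
    have fr: "arrs s' ''par'' = par" "regs s' ''n'' = n"
      using 2(2) n by (simp_all add: frame_def par_def)
    have w: "regs s' ''w'' < n" using 2(3) fr by simp
    show ?case
    proof (cases "par (regs s' ''w'')")
      case 0
      then show ?thesis
        using 2(1) w unfolding I_def by (auto simp: fr intro: listed_skip)
    next
      case (Suc c)
      then show ?thesis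
        using 2(1) w listed_push[OF _ st0 w Suc] unfolding I_def by (auto simp: fr)
    qed
  next
    case (3 \<phi> t s')
    have "regs s' ''n'' = n" using 3(2) n by (simp add: frame_def)
    then have "regs s' ''w'' = n" using 3(1,3) unfolding I_def by simp
    then have "listed par cnt0 n (arrs s' ''cnt'') (regs s' ''len'') (arrs s' ''index'')
        (arrs s' ''end1'') (arrs s' ''end2'')"
      using 3(1) unfolding I_def by simp
    from listed_cover[OF this st0] cov 3(4) show ?case
      unfolding out_indices_def out_matchings_def covered_def par_def cnt0_def by simp
  qed
qed

end

section \<open>Correctness and total running time\<close>

context input_graph
begin

lemma has_input_input_state: "has_input (input_state n es k)"
  unfolding has_input_def input_state_def by simp

text \<open>
  With more than one node, connectivity leaves no node isolated. A graph with a single node has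
  no edges; there the summand \<open>1\<close> in the time bound is needed.
\<close>

lemma nodes_le_edges:
  assumes "graph_connected {..<n} E" "n \<noteq> 1"
  shows "n \<le> 2 * length es"
proof -
  have "{..<n} \<subseteq> fst ` set es \<union> snd ` set es"
  proof
    fix u assume "u \<in> {..<n}"
    then have u: "u < n" by simp
    define v where "v = (if u = 0 then 1 else 0 :: nat)"
    have v: "v < n" "u \<noteq> v" using u assms(2) by (auto simp: v_def)
    have "(u, v) \<in> {(x, y). {x, y} \<in> E}\<^sup>*"
      using assms(1) u v(1) unfolding graph_connected_def by blast
    then obtain w where "{u, w} \<in> E"
      using v(2) by (auto elim: converse_rtranclE)
    then obtain j where "j < length es" "{u, w} = {fst (es ! j), snd (es ! j)}"
      using ex_edge_at by blast
    then show "u \<in> fst ` set es \<union> snd ` set es"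
      by (auto simp: doubleton_eq_iff)
  qed
  then have "card {..<n} \<le> card (fst ` set es \<union> snd ` set es)" by (intro card_mono) auto
  also have "\<dots> \<le> card (fst ` set es) + card (snd ` set es)" by (rule card_Un_le)
  also have "\<dots> \<le> length es + length es"
    by (intro add_mono order_trans[OF card_image_le card_length]) simp_all
  finally show ?thesis by simp
qed

lemma cover_program:
  "wp cover_program (\<lambda>t s. t \<le> 5000 * (n * length es + n * n + n + 1) \<and>
    (regs s ''cover'' = 1 \<and> out_indices s \<subseteq> {..<k} \<and>
       matching_k_cover {..<n} E k (out_matchings s) \<or>
     regs s ''cover'' = 0 \<and> stable_set {..<n} E (out_nodes s) \<and>
       card (out_nodes s) > k * card (nbhd {..<n} E (out_nodes s)))) (input_state n es k)"
proof -
  let ?post = "\<lambda>t s. t \<le> 5000 * (n * length es + n * n + n + 1) \<and>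
    (regs s ''cover'' = 1 \<and> out_indices s \<subseteq> {..<k} \<and>
       matching_k_cover {..<n} E k (out_matchings s) \<or>
     regs s ''cover'' = 0 \<and> stable_set {..<n} E (out_nodes s) \<and>
       card (out_nodes s) > k * card (nbhd {..<n} E (out_nodes s)))"
  let ?finish = "Branch (Equal (Reg ''cover'') (Const 1))
        (block [Assign ''len'' (Const 0), Assign ''w'' (Const 0), list_edges])
        Skip"
  define s0 where "s0 = input_state n es k"
  have zero: "regs s0 x = 0" if "x \<notin> {''n'', ''m'', ''k''}" for x
    using that by (simp add: s0_def input_state_def)
  have zero': "arrs s0 A = (\<lambda>_. 0)" if "A \<notin> {''src'', ''dst''}" for A
    using that by (auto simp: s0_def input_state_def fun_eq_iff)
  have "200 * weight {..<n} \<le> 200 * n + 400 * length es" using weight_all by simp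
  then have "n * (200 * weight {..<n} + 30 * n + 300) \<le>
      n * (200 * n + 400 * length es + 30 * n + 300)"
    by (intro mult_le_mono2) simp
  then have bound: "n * (200 * weight {..<n} + 30 * n + 300) \<le>
      230 * (n * n) + 400 * (n * length es) + 300 * n"
    by (simp add: algebra_simps)
  have finish: "wp ?finish (\<lambda>t. ?post (t + t1)) s2"
    if t1: "t1 \<le> 460 * (n * length es) + 230 * (n * n) + 400 * n + 100"
      and s2: "regs s2 ''cover'' = 1 \<and> adjacency s2 \<and>
          star_system (arrs s2 ''par'') (arrs s2 ''cnt'') {} \<and> (\<forall>v<n. covered s2 v) \<or>
        regs s2 ''cover'' = 0 \<and> violated s2" for t1 s2
    using s2
  proof (elim disjE conjE)
    assume cover: "regs s2 ''cover'' = 1" and adj: "adjacency s2"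
      and st: "star_system (arrs s2 ''par'') (arrs s2 ''cnt'') {}" and cov: "\<forall>v<n. covered s2 v"
    define s3 where "s3 = set_reg ''w'' 0 (set_reg ''len'' 0 s2)"
    have "wp list_edges (\<lambda>t s'. t \<le> 60 * n + 10 \<and> out_indices s' \<subseteq> {..<k} \<and>
        matching_k_cover {..<n} E k (out_matchings s')) s3"
      using adj st cov by (intro list_edges) (auto simp: s3_def adjacency_def covered_def)
    then show ?thesis
      using cover
      apply (simp flip: s3_def)
      apply (erule wp_conseq)
      using t1 by (simp add: frame_def list_edges_def s3_def algebra_simps)
  next
    assume cover: "regs s2 ''cover'' = 0" and "violated s2"
    moreover have "out_nodes s2 = arrs s2 ''node'' ` {..<regs s2 ''len''}"
      unfolding out_nodes_def by blast
    ultimately show ?thesis using t1 unfolding violated_def by (simp add: Let_def)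
  qed
  have "wp build_adjacency (\<lambda>t s'. t \<le> n * (40 * length es + 40) + 10 \<and> adjacency s') s0"
    by (rule build_adjacency) (simp_all add: zero zero' has_input_input_state[folded s0_def])
  then have "wp build_adjacency (\<lambda>t s'. wp cover_all (\<lambda>t' s''.
      wp ?finish (\<lambda>t''. ?post (t'' + (t + t' + 40))) s'') (set_reg ''cover'' 1 s')) s0"
  proof (rule wp_conseq, goal_cases)
    case (1 t s1)
    let ?s = "set_reg ''cover'' 1 s1"
    have fr: "regs s1 ''r'' = 0" "arrs s1 ''par'' = (\<lambda>_. 0)" "arrs s1 ''cnt'' = (\<lambda>_. 0)"
      "arrs s1 ''mark'' = (\<lambda>_. 0)"
      using 1(2) by (simp_all add: frame_def build_adjacency_def scan_edges_def zero zero')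
    have "adjacency ?s" using 1(1) unfolding adjacency_def by simp
    then have "wp cover_all (\<lambda>t s'. t \<le> n * (200 * weight {..<n} + 30 * n + 300) + 20 \<and>
      (regs s' ''cover'' = 1 \<and> adjacency s' \<and>
         star_system (arrs s' ''par'') (arrs s' ''cnt'') {} \<and> (\<forall>v<n. covered s' v) \<or>
       regs s' ''cover'' = 0 \<and> violated s')) ?s"
      by (rule cover_all) (simp_all add: fr)
    then show ?case
    proof (rule wp_conseq, goal_cases)
      case (1 t' s2)
      have "t + t' + 40 \<le> 460 * (n * length es) + 230 * (n * n) + 400 * n + 100"
        using \<open>t \<le> n * (40 * length es + 40) + 10 \<and> adjacency s1\<close> 1(1) bound
        by (simp add: algebra_simps)
      then show ?case using 1(1) by (intro finish) blast+
    qed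
  qed
  then show ?thesis
    unfolding cover_program_def block.simps wp_Seq s0_def[symmetric] wp_Assign wp_Skip
  proof (rule wp_conseq, goal_cases)
    case (1 t s1)
    from 1(1) show ?case
      apply (simp only: eval_expr.simps)
      apply (erule wp_conseq)
      apply (erule wp_conseq)
      apply (elim conjE, intro conjI)
       apply simp_all
      done
  qed
qed

end

theorem mainTheorem5:
  shows "\<exists>(prog :: com) (C :: nat).
    \<forall>(n :: nat) (E :: nat set set) (es :: (nat \<times> nat) list) (k :: nat).
      simple_graph {..<n} E \<and> graph_connected {..<n} E \<and> edge_listing E es \<and> k \<ge> 2 \<longrightarrow>
      (\<exists>t s. exec prog (input_state n es k) t s \<and>
             t \<le> C * (n * card E + 1) \<and>
             ((regs s ''cover'' = 1 \<and>
               out_indices s \<subseteq> {..<k} \<and>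
               matching_k_cover {..<n} E k (out_matchings s)) \<or>
              (regs s ''cover'' = 0 \<and>
               stable_set {..<n} E (out_nodes s) \<and>
               card (out_nodes s) > k * card (nbhd {..<n} E (out_nodes s)))))"
proof (rule exI[of _ cover_program], rule exI[of _ 25000], intro allI impI, elim conjE)
  fix n k :: nat and E :: "nat set set" and es :: "(nat \<times> nat) list"
  assume "simple_graph {..<n} E" "edge_listing E es" "2 \<le> k"
    and connected: "graph_connected {..<n} E"
  then interpret input_graph n E es k by unfold_locales
  have "n * length es + n * n + n + 1 \<le> 5 * (n * card E + 1)"
  proof (cases "n = 1")
    case True
    then show ?thesis by (simp add: card_E)
  next
    case False
    have le: "n \<le> 2 * length es" using connected False by (rule nodes_le_edges)
    have "n * n \<le> 2 * (n * length es)" using mult_le_mono2[OF le, of n] by (simp only: mult_ac)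
    then show ?thesis using le_square[of n] unfolding card_E distrib_left mult_1_right by linarith
  qed
  then have "5000 * (n * length es + n * n + n + 1) \<le> 25000 * (n * card E + 1)" by simp
  then show "\<exists>t s. exec cover_program (input_state n es k) t s \<and>
      t \<le> 25000 * (n * card E + 1) \<and>
      (regs s ''cover'' = 1 \<and> out_indices s \<subseteq> {..<k} \<and>
         matching_k_cover {..<n} E k (out_matchings s) \<or>
       regs s ''cover'' = 0 \<and> stable_set {..<n} E (out_nodes s) \<and>
         card (out_nodes s) > k * card (nbhd {..<n} E (out_nodes s)))"
    using cover_program unfolding wp_def by (blast intro: order_trans)
qed

end
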